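(* Let $W$ be a space of quasi-exponentials with a basis $\{\alpha_i^xq_{ij}(x): i=1,\dots,n,\ j=1,\dots,n_i\}$, where $\alpha_1,\dots,\alpha_n$ are pairwise distinct nonzero complex numbers, $\mu^{(1)},\dots,\mu^{(n)}$ are nonzero partitions, $n_i=(\mu^{(i)})'_1$, and $q_{ij}$ are polynomials with $\deg q_{ij}=n_i+\mu^{(i)}_j-j$. Then the space $Q(W)$ has a basis of the form $$\{\alpha_i^{-x}\check q_{ij}(x): i=1,\dots,n,\ j=1,\dots,\mu^{(i)}_1\},$$ where $\check q_{ij}$ are polynomials with $\deg\check q_{ij}=\mu^{(i)}_1+(\mu^{(i)})'_j-j$, $i=1,\dots,n$, $j=1,\dots,\mu_1^{(i)}$.
   Context: Fix a branch of $\ln$; $\alpha^x=e^{x\ln\alpha}$, $\alpha^{-x}=e^{-x\ln\alpha}$. $(Tf)(x)=f(x+1)$. A partition is an infinite nonincreasing sequence of nonnegative integers stabilizing at zero; $\mu'$ is its conjugate, $\mu'_i=\#\{j:\mu_j\ge i\}$. Discrete Wronskian: $\mathcal{W}(g_1,\dots,g_m)=\det\big((T^{j-1}g_i)_{i,j=1}^m\big)$ (equal to $1$ if $m=0$). Definition of $Q(W)$: put $p_i=\mu^{(i)}_1+n_i$, $M'=\sum_in_i=\dim W$, $M=\sum_i\mu^{(i)}_1$, and let $\widehat W$ be the span of $\alpha_i^xx^p$, $i=1,\dots,n$, $p=0,\dots,p_i-1$, so $W\subset\widehat W$. Choose a basis $f_1,\dots,f_{M'}$ of $W$ and complete it by $h_1,\dots,h_M$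 to a basis of $\widehat W$. $Q(W)$ is the span (independent of choices) of $$\phi_a=T\left(\frac{\mathcal{W}(f_1,\dots,f_{M'},h_1,\dots,h_{a-1},h_{a+1},\dots,h_M)}{\mathcal{W}(f_1,\dots,f_{M'},h_1,\dots,h_M)}\right),\quad a=1,\dots,M.$$ *)

theory Defs
  imports
    Complex_Main
    "HOL-Library.Function_Algebras"
    "HOL-Computational_Algebra.Polynomial"
    "Jordan_Normal_Form.Determinant"
begin

definition cscale :: "complex \<Rightarrow> (complex \<Rightarrow> complex) \<Rightarrow> (complex \<Rightarrow> complex)" where
  "cscale c f = (\<lambda>x. c * f x)"

global_interpretation cfun: vector_space cscale
  by unfold_locales (auto simp: cscale_def fun_eq_iff algebra_simps)

definition basis_family :: "(complex \<Rightarrow> complex) set \<Rightarrow> 'i set \<Rightarrow> ('i \<Rightarrow> complex \<Rightarrow> complex) \<Rightarrow> bool" where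
  "basis_family V I b \<longleftrightarrow>
     inj_on b I \<and> cfun.independent (b ` I) \<and> cfun.span (b ` I) = V"

definition basis_list :: "(complex \<Rightarrow> complex) set \<Rightarrow> (complex \<Rightarrow> complex) list \<Rightarrow> bool" where
  "basis_list V fs \<longleftrightarrow> basis_family V {..<length fs} (\<lambda>k. fs ! k)"

text \<open>
  Partitions are functions on the positive integers: the parts of \<open>\<mu>\<close> are
  \<open>\<mu> 1, \<mu> 2, \<dots>\<close>, and the value \<open>\<mu> 0\<close> is irrelevant.
\<close>

definition is_partition :: "(nat \<Rightarrow> nat) \<Rightarrow> bool" where
  "is_partition \<mu> \<longleftrightarrow>
     (\<forall>i j. 1 \<le> i \<and> i \<le> j \<longrightarrow> \<mu> j \<le> \<mu> i) \<and> (\<exists>N. \<forall>i\<ge>N. \<mu> i = 0)"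

definition nonzero_partition :: "(nat \<Rightarrow> nat) \<Rightarrow> bool" where
  "nonzero_partition \<mu> \<longleftrightarrow> is_partition \<mu> \<and> (\<exists>j\<ge>1. \<mu> j \<noteq> 0)"

definition conj_part :: "(nat \<Rightarrow> nat) \<Rightarrow> nat \<Rightarrow> nat" where
  "conj_part \<mu> i = card {j. 1 \<le> j \<and> i \<le> \<mu> j}"

text \<open>
  A branch of the logarithm enters only through its values, so it is an arbitrary
  right inverse of \<open>exp\<close> on the nonzero complex numbers.
\<close>

definition log_branch :: "(complex \<Rightarrow> complex) \<Rightarrow> bool" where
  "log_branch lg \<longleftrightarrow> (\<forall>z. z \<noteq> 0 \<longrightarrow> exp (lg z) = z)"

definition cpow :: "(complex \<Rightarrow> complex) \<Rightarrow> complex \<Rightarrow> complex \<Rightarrow> complex" where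
  "cpow lg \<alpha> x = exp (x * lg \<alpha>)"

definition shift :: "(complex \<Rightarrow> complex) \<Rightarrow> (complex \<Rightarrow> complex)" where
  "shift f = (\<lambda>x. f (x + 1))"

definition dwronskian :: "(complex \<Rightarrow> complex) list \<Rightarrow> complex \<Rightarrow> complex" where
  "dwronskian gs x =
     det (mat (length gs) (length gs) (\<lambda>(i, j). (shift ^^ j) (gs ! i) x))"

definition W_hat ::
  "(complex \<Rightarrow> complex) \<Rightarrow> nat \<Rightarrow> (nat \<Rightarrow> complex) \<Rightarrow> (nat \<Rightarrow> nat \<Rightarrow> nat) \<Rightarrow> (complex \<Rightarrow> complex) set" where
  "W_hat lg n \<alpha> \<mu> =
     cfun.span {(\<lambda>x. cpow lg (\<alpha> i) x * x ^ p) | i p.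
       i \<in> {1..n} \<and> p < \<mu> i 1 + conj_part (\<mu> i) 1}"

definition Q_gen ::
  "(complex \<Rightarrow> complex) list \<Rightarrow> (complex \<Rightarrow> complex) list \<Rightarrow> nat \<Rightarrow> (complex \<Rightarrow> complex)" where
  "Q_gen fs hs a =
     shift (\<lambda>x. dwronskian (fs @ take a hs @ drop (Suc a) hs) x / dwronskian (fs @ hs) x)"

text \<open>
  The definite description asserts that the span does not depend on the chosen bases.
  Here \<open>a\<close> runs over \<open>0, \<dots>, M - 1\<close>, where \<open>M = length hs = dim (W_hat \<dots>) - dim W\<close>.
\<close>

definition Q_space ::
  "(complex \<Rightarrow> complex) \<Rightarrow> nat \<Rightarrow> (nat \<Rightarrow> complex) \<Rightarrow> (nat \<Rightarrow> nat \<Rightarrow> nat) \<Rightarrow>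
   (complex \<Rightarrow> complex) set \<Rightarrow> (complex \<Rightarrow> complex) set" where
  "Q_space lg n \<alpha> \<mu> W =
     (THE V. \<exists>fs hs. basis_list W fs \<and> basis_list (W_hat lg n \<alpha> \<mu>) (fs @ hs) \<and>
        V = cfun.span (Q_gen fs hs ` {..<length hs}))"

end

theory Submission imports Defs begin

text \<open>
  For a basis \<open>b\<close> of the \<open>N\<close>-dimensional space \<open>W_hat\<close>, Cramer's rule identifies the quotients of
  Wronskians, up to signs and a common constant, with the functions \<open>\<psi> a\<close> determined by
  \<open>\<Sum>a. \<psi> a x * b a (x + j) = \<delta>\<^bsub>j0\<^esub>\<close> for \<open>j < N\<close>. The tensor \<open>\<Sum>a. \<psi> a \<otimes> b a\<close> does not
  depend on the basis, so \<open>Q W\<close> is spanned by the \<open>\<psi> a\<close> belonging to any complement of \<open>W\<close>. Take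
  the basis \<open>\<alpha>\<^sub>i\<^sup>x r\<^sub>i\<^sub>k\<close> with \<open>deg r\<^sub>i\<^sub>k = k < p\<^sub>i\<close>, where the \<open>q\<^sub>i\<^sub>j\<close> are among the \<open>r\<^sub>i\<^sub>k\<close>. Since
  \<open>N\<close> consecutive values determine a quasi-exponential, the dual functions are \<open>\<alpha>\<^sub>i\<^sup>-\<^sup>x s\<^sub>i\<^sub>k\<close> with
  \<open>\<Sum>k. s\<^sub>i\<^sub>k x * r\<^sub>i\<^sub>k t = F\<^sub>i (t - x)\<close> for fixed polynomials \<open>F\<^sub>i\<close> of degree \<open>p\<^sub>i - 1\<close>, whence
  \<open>deg s\<^sub>i\<^sub>k = p\<^sub>i - 1 - k\<close>. The remaining degrees \<open>k\<close>, the complement of \<open>{n\<^sub>i + \<mu>\<^sub>j - j}\<close> in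
  \<open>{0, \<dots>, p\<^sub>i - 1}\<close>, are the numbers \<open>n\<^sub>i - 1 + j - \<mu>'\<^sub>j\<close>.
\<close>

subsection \<open>Finite families of functions\<close>

lemma sum_fun_apply: "(\<Sum>k\<in>K. f k) x = (\<Sum>k\<in>K. f k x)"
  for f :: "'i \<Rightarrow> 'a \<Rightarrow> 'b::comm_monoid_add"
  by (induction K rule: infinite_finite_induct) auto

lemma span_family_iff:
  assumes "finite K"
  shows "f \<in> cfun.span (b ` K) \<longleftrightarrow> (\<exists>c. \<forall>x. f x = (\<Sum>k\<in>K. c k * b k x))"
proof
  assume "f \<in> cfun.span (b ` K)"
  then show "\<exists>c. \<forall>x. f x = (\<Sum>k\<in>K. c k * b k x)"
  proof (induction rule: cfun.span_induct_alt)
    case base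
    show ?case by (rule exI[of _ "\<lambda>_. 0"]) simp
  next
    case (step a g h)
    then obtain k c where k: "k \<in> K" "g = b k" and c: "\<And>x. h x = (\<Sum>k\<in>K. c k * b k x)"
      by auto
    have "(cscale a g + h) x = (\<Sum>l\<in>K. (c l + (if l = k then a else 0)) * b l x)" for x
    proof -
      have "(\<Sum>l\<in>K. (c l + (if l = k then a else 0)) * b l x)
          = h x + (\<Sum>l\<in>K. if l = k then a * b l x else 0)"
        unfolding c sum.distrib[symmetric] by (rule sum.cong) (auto simp: algebra_simps)
      then show ?thesis using k assms by (simp add: cscale_def)
    qed
    then show ?case by (intro exI[of _ "\<lambda>l. c l + (if l = k then a else 0)"]) blast
  qed
next
  assume "\<exists>c. \<forall>x. f x = (\<Sum>k\<in>K. c k * b k x)"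
  then obtain c where "\<And>x. f x = (\<Sum>k\<in>K. c k * b k x)" by blast
  then have "f = (\<Sum>k\<in>K. cscale (c k) (b k))"
    by (auto simp: fun_eq_iff sum_fun_apply cscale_def)
  also have "\<dots> \<in> cfun.span (b ` K)"
    by (intro cfun.span_sum cfun.span_scale cfun.span_base) auto
  finally show "f \<in> cfun.span (b ` K)" .
qed

text \<open>Injectivity belongs to the equivalence: a repeated member of the family is itself a
  nontrivial linear relation between two indices.\<close>

lemma independent_family_iff:
  assumes "finite K"
  shows "inj_on b K \<and> cfun.independent (b ` K) \<longleftrightarrow>
    (\<forall>c. (\<forall>x. (\<Sum>k\<in>K. c k * b k x) = 0) \<longrightarrow> (\<forall>k\<in>K. c k = 0))"
    (is "?L \<longleftrightarrow> ?R")
proof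
  assume L: ?L
  show ?R
  proof (intro allI impI ballI)
    fix c k assume c: "\<forall>x. (\<Sum>k\<in>K. c k * b k x) = 0" and k: "k \<in> K"
    have "(\<Sum>v\<in>b ` K. cscale (c (the_inv_into K b v)) v) = (\<Sum>k\<in>K. cscale (c k) (b k))"
      using L by (subst sum.reindex) (auto simp: the_inv_into_f_f)
    also have "\<dots> = 0" using c by (auto simp: fun_eq_iff sum_fun_apply cscale_def)
    finally have "c (the_inv_into K b (b k)) = 0"
      using cfun.independentD[of "b ` K" "b ` K" "\<lambda>v. c (the_inv_into K b v)" "b k"] L k assms
      by auto
    then show "c k = 0" using L k by (simp add: the_inv_into_f_f)
  qed
next
  assume R: ?R
  have inj: "inj_on b K"
  proof (rule inj_onI, rule ccontr)
    fix k l assume kl: "k \<in> K" "l \<in> K" "b k = b l" "k \<noteq> l"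
    define c where "c = (\<lambda>i. (if i = k then 1 else 0) - (if i = l then 1 else 0) :: complex)"
    have "(\<Sum>i\<in>K. c i * b i x)
        = (\<Sum>i\<in>K. (if i = k then b i x else 0) - (if i = l then b i x else 0))" for x
      by (rule sum.cong) (auto simp: c_def)
    then have "(\<Sum>i\<in>K. c i * b i x) = 0" for x
      using kl assms by (simp add: sum_subtractf)
    then have "c k = 0" using R kl by blast
    then show False using kl by (simp add: c_def)
  qed
  moreover have "cfun.independent (b ` K)"
  proof (rule cfun.independent_if_scalars_zero)
    fix u v assume u: "(\<Sum>v\<in>b ` K. cscale (u v) v) = 0" and v: "v \<in> b ` K"
    have s: "(\<Sum>k\<in>K. cscale (u (b k)) (b k)) = 0"
      using u by (simp add: sum.reindex[OF inj] o_def)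
    have "(\<Sum>k\<in>K. (u \<circ> b) k * b k x) = (\<Sum>k\<in>K. cscale (u (b k)) (b k)) x" for x
      by (simp add: sum_fun_apply cscale_def)
    then have "\<forall>x. (\<Sum>k\<in>K. (u \<circ> b) k * b k x) = 0" unfolding s by simp
    then have "\<forall>k\<in>K. (u \<circ> b) k = 0" using R by blast
    then show "u v = 0" using v by auto
  qed (use assms in auto)
  ultimately show ?L by blast
qed

lemma basis_familyD:
  assumes "basis_family V K b" "finite K" "\<And>x. (\<Sum>k\<in>K. c k * b k x) = 0" "k \<in> K"
  shows "c k = 0"
  using assms independent_family_iff[of K b] unfolding basis_family_def by blast

lemma card_basis_family:
  assumes "basis_family V K b" "basis_family V J b'"
  shows "card K = card J"
proof -
  have "card (b ` K) = card (b' ` J)"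
    using assms cfun.dim_eq_card[of "b ` K" V] cfun.dim_eq_card[of "b' ` J" V]
    unfolding basis_family_def by (metis cfun.span_span)
  then show ?thesis using assms by (simp add: basis_family_def card_image)
qed

lemma basis_family_reindex:
  assumes "bij_betw h J K" "basis_family V K b"
  shows "basis_family V J (b \<circ> h)"
proof -
  have h: "inj_on h J" "h ` J = K" using assms(1) by (auto simp: bij_betw_def)
  then have "(b \<circ> h) ` J = b ` K" by (metis image_comp)
  moreover have "inj_on (b \<circ> h) J"
    using h assms(2) by (auto simp: basis_family_def intro: comp_inj_on)
  ultimately show ?thesis using assms(2) by (simp add: basis_family_def)
qed

subsection \<open>Polynomials\<close>

text \<open>The degree bound is expressed by vanishing coefficients, so that \<open>m = 0\<close>
  describes exactly the zero polynomial.\<close>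

lemma coeff_pcompose_shift:
  fixes F :: "'a::field_char_0 poly"
  assumes "\<And>k. m \<le> k \<Longrightarrow> coeff F k = 0" "m \<le> k"
  shows "coeff (F \<circ>\<^sub>p [:x, 1:]) k = 0"
proof (cases "F = 0")
  case False
  then have "degree F < m" using assms(1)[of "degree F"] by (metis leading_coeff_0_iff not_le)
  then show ?thesis using assms(2) by (intro coeff_eq_0) (auto simp: degree_pcompose)
qed simp

text \<open>Translation keeps the leading coefficient, so the difference loses the top degree: the
  bound drops from \<open>m\<close> to \<open>m - 1\<close>.\<close>

lemma coeff_pcompose_shift_diff:
  fixes F :: "'a::field_char_0 poly"
  assumes "\<And>k. m \<le> k \<Longrightarrow> coeff F k = 0" "m \<le> Suc k"
  shows "coeff (F \<circ>\<^sub>p [:x, 1:] - F) k = 0"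
proof (cases "m \<le> k")
  case True
  then show ?thesis using coeff_pcompose_shift[of m F k x] assms by simp
next
  case False
  then have m: "m = Suc k" using assms by simp
  show ?thesis
  proof (cases "coeff F k = 0")
    case True
    then have "coeff F l = 0" if "k \<le> l" for l using assms(1)[of l] m that by (cases "l = k") auto
    then show ?thesis using coeff_pcompose_shift[of k F k x] True by simp
  next
    case False
    moreover have "degree F \<le> k" using assms(1) m by (intro degree_le) auto
    ultimately have "degree F = k" using le_degree[of F k] by simp
    then show ?thesis using lead_coeff_comp[of "[:x,1:]" F] by (simp add: degree_pcompose)
  qed
qed

text \<open>
  Nonsingularity of the confluent Vandermonde matrix. The operator \<open>T - \<alpha> i\<^sub>0\<close> lowers the degree of
  the coefficient at \<open>\<alpha> i\<^sub>0\<close>, preserves the other degrees and costs one sample point.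
\<close>

lemma exp_poly_eq_0:
  fixes \<alpha> :: "'i \<Rightarrow> 'a::field_char_0"
  assumes "finite I" "inj_on \<alpha> I" "\<And>i. i \<in> I \<Longrightarrow> \<alpha> i \<noteq> 0"
    and "\<And>i k. i \<in> I \<Longrightarrow> p i \<le> k \<Longrightarrow> coeff (F i) k = 0"
    and "\<And>j. j < sum p I \<Longrightarrow> (\<Sum>i\<in>I. \<alpha> i ^ j * poly (F i) (x + of_nat j)) = 0"
    and "i \<in> I"
  shows "F i = 0"
  using assms(4-6)
proof (induction "sum p I" arbitrary: p F i)
  case 0
  then have "p i = 0" using assms(1) by auto
  then show ?case using 0 by (intro poly_eqI) auto
next
  case (Suc N)
  obtain i0 where i0: "i0 \<in> I" "p i0 > 0"
    using Suc(2) by (metis gr0I nat.distinct(1) sum.neutral)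
  define G where "G = (\<lambda>i. smult (\<alpha> i) (F i \<circ>\<^sub>p [:1, 1:]) - smult (\<alpha> i0) (F i))"
  define p' where "p' = p(i0 := p i0 - 1)"
  have "sum p I = p i0 + sum p (I - {i0})" "sum p' I = p' i0 + sum p' (I - {i0})"
    using assms(1) i0 by (auto intro: sum.remove)
  moreover have "sum p' (I - {i0}) = sum p (I - {i0})"
    by (rule sum.cong) (auto simp: p'_def)
  ultimately have N: "N = sum p' I" using i0 Suc(2) by (simp add: p'_def)
  have G0: "G i = 0" if "i \<in> I" for i
  proof (rule Suc.hyps(1)[OF N _ _ that])
    fix i k assume i: "i \<in> I" "p' i \<le> k"
    have Fk: "\<And>k. p i \<le> k \<Longrightarrow> coeff (F i) k = 0" using Suc(3) i by blast
    show "coeff (G i) k = 0"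
    proof (cases "i = i0")
      case True
      have "G i = smult (\<alpha> i0) (F i \<circ>\<^sub>p [:1, 1:] - F i)"
        by (simp add: G_def True smult_diff_right)
      moreover have "coeff (F i \<circ>\<^sub>p [:1, 1:] - F i) k = 0"
        by (rule coeff_pcompose_shift_diff[OF Fk]) (use i True i0 in \<open>auto simp: p'_def\<close>)
      ultimately show ?thesis by simp
    next
      case False
      then have "p i \<le> k" using i by (simp add: p'_def)
      then show ?thesis using coeff_pcompose_shift[of "p i" "F i" k 1] Fk by (simp add: G_def)
    qed
  next
    fix j assume j: "j < sum p' I"
    have "(\<Sum>i\<in>I. \<alpha> i ^ j * poly (G i) (x + of_nat j))
        = (\<Sum>i\<in>I. \<alpha> i ^ Suc j * poly (F i) (x + of_nat (Suc j))
             - \<alpha> i0 * (\<alpha> i ^ j * poly (F i) (x + of_nat j)))"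
      by (rule sum.cong) (auto simp: G_def poly_pcompose algebra_simps)
    also have "\<dots> = (\<Sum>i\<in>I. \<alpha> i ^ Suc j * poly (F i) (x + of_nat (Suc j)))
             - \<alpha> i0 * (\<Sum>i\<in>I. \<alpha> i ^ j * poly (F i) (x + of_nat j))"
      by (simp add: sum_subtractf sum_distrib_left)
    also have "\<dots> = 0" using Suc(4)[of j] Suc(4)[of "Suc j"] j N Suc(2) by simp
    finally show "(\<Sum>i\<in>I. \<alpha> i ^ j * poly (G i) (x + of_nat j)) = 0" .
  qed
  \<comment> \<open>Away from \<open>i0\<close>, compare leading coefficients in
    \<open>G i = 0\<close>: translation does not change them, while \<open>\<alpha> i\<close> and
    \<open>\<alpha> i0\<close> differ.\<close>
  have other: "F i = 0" if "i \<in> I" "i \<noteq> i0" for i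
  proof -
    have "smult (\<alpha> i) (F i \<circ>\<^sub>p [:1, 1:]) = smult (\<alpha> i0) (F i)"
      using G0[OF that(1)] by (simp add: G_def)
    then have "\<alpha> i * coeff (F i \<circ>\<^sub>p [:1, 1:]) (degree (F i)) = \<alpha> i0 * lead_coeff (F i)"
      by (metis coeff_smult)
    moreover have "coeff (F i \<circ>\<^sub>p [:1, 1:]) (degree (F i)) = lead_coeff (F i)"
      using lead_coeff_comp[of "[:1,1:]" "F i"] by (simp add: degree_pcompose)
    ultimately have "(\<alpha> i - \<alpha> i0) * lead_coeff (F i) = 0" by (simp add: algebra_simps)
    moreover have "\<alpha> i \<noteq> \<alpha> i0" using assms(2) that i0 by (auto dest: inj_onD)
    ultimately show ?thesis by simp
  qed
  \<comment> \<open>At \<open>i0\<close> the equation \<open>G i0 = 0\<close> only gives period 1.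
    The sample at \<open>j = 0\<close> now sees \<open>F i0\<close> alone, so \<open>F i0\<close>
    vanishes at \<open>x\<close> and hence at infinitely many points.\<close>
  have per: "poly (F i0) (y + 1) = poly (F i0) y" for y
  proof -
    have "poly (G i0) y = 0" using G0 i0 by simp
    then have "\<alpha> i0 * (poly (F i0) (y + 1) - poly (F i0) y) = 0"
      by (simp add: G_def poly_pcompose algebra_simps)
    then show ?thesis using assms(3) i0 by simp
  qed
  have "(\<Sum>i\<in>I. \<alpha> i ^ 0 * poly (F i) (x + of_nat 0)) = poly (F i0) x"
    using assms(1) i0 other by (subst sum.remove[of I i0]) (auto intro!: sum.neutral)
  then have "poly (F i0) x = 0" using Suc(4)[of 0] Suc(2) by simp
  then have "poly (F i0) (x + of_nat j) = 0" for j
  proof (induction j)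
    case (Suc j)
    have "x + of_nat (Suc j) = x + of_nat j + 1" by simp
    then show ?case using per[of "x + of_nat j"] Suc by metis
  qed simp
  then have "range (\<lambda>j. x + of_nat j) \<subseteq> {y. poly (F i0) y = 0}" by auto
  moreover have "infinite (range (\<lambda>j. x + (of_nat j :: 'a)))"
    by (intro range_inj_infinite injI) simp
  ultimately have "F i0 = 0" using poly_roots_finite finite_subset by blast
  then show ?case using other Suc.prems(3) by (cases "i = i0") auto
qed

section \<open>Expansions of polynomials in one and two variables\<close>

lemma triangular_expansion:
  fixes r :: "nat \<Rightarrow> 'a::field poly"
  assumes "\<And>k. k < d \<Longrightarrow> degree (r k) = k \<and> r k \<noteq> 0" "\<And>k. d \<le> k \<Longrightarrow> coeff F k = 0"
  shows "\<exists>c. F = (\<Sum>k<d. smult (c k) (r k))"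
  using assms
proof (induction d arbitrary: F)
  case 0
  then have "F = 0" by (intro poly_eqI) simp
  then show ?case by simp
next
  case (Suc d)
  define a where "a = coeff F d / lead_coeff (r d)"
  have lc: "degree (r d) = d" "lead_coeff (r d) \<noteq> 0"
    using Suc.prems(1)[of d] leading_coeff_0_iff[of "r d"] by blast+
  have "coeff (F - smult a (r d)) k = 0" if "d \<le> k" for k
  proof (cases "k = d")
    case True
    then show ?thesis using lc by (simp add: a_def)
  next
    case False
    then show ?thesis using that lc Suc.prems(2)[of k] by (simp add: coeff_eq_0)
  qed
  then obtain c where "F - smult a (r d) = (\<Sum>k<d. smult (c k) (r k))"
    using Suc.IH Suc.prems by (metis less_SucI)
  then have "F = (\<Sum>k<Suc d. smult ((c(d := a)) k) (r k))" by (simp add: algebra_simps)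
  then show ?case by blast
qed

text \<open>A change of basis in the variable \<open>t\<close>, from powers to the polynomials
  \<open>r k\<close>. Eliminating the top power corrects the lower coefficients by multiples of
  \<open>g d\<close>, whose degree \<open>D - d\<close> lies below \<open>D - k\<close>, so the
  degrees survive.\<close>

lemma triangular_coefficients:
  fixes r g :: "nat \<Rightarrow> 'a::field poly"
  assumes "\<And>k. k < d \<Longrightarrow> degree (r k) = k \<and> r k \<noteq> 0"
    and "\<And>k. k < d \<Longrightarrow> degree (g k) = D - k \<and> g k \<noteq> 0" and "d \<le> Suc D"
  shows "\<exists>s. (\<forall>k<d. degree (s k) = D - k \<and> s k \<noteq> 0) \<and>
    (\<forall>x t. (\<Sum>k<d. poly (s k) x * poly (r k) t) = (\<Sum>k<d. poly (g k) x * t ^ k))"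
  using assms
proof (induction d arbitrary: g)
  case 0
  then show ?case by simp
next
  case (Suc d)
  define a where "a = inverse (lead_coeff (r d))"
  have lc: "degree (r d) = d" "lead_coeff (r d) \<noteq> 0"
    using Suc.prems(1)[of d] leading_coeff_0_iff[of "r d"] by blast+
  have gd: "degree (g d) = D - d" "g d \<noteq> 0" using Suc.prems(2)[of d] by auto
  define g' where "g' = (\<lambda>k. g k - smult (a * coeff (r d) k) (g d))"
  have "degree (g' k) = D - k \<and> g' k \<noteq> 0" if "k < d" for k
  proof -
    have gk: "degree (g k) = D - k" "g k \<noteq> 0" using Suc.prems(2)[of k] that by auto
    have "degree (- smult (a * coeff (r d) k) (g d)) \<le> D - d" using gd(1)
      by (metis degree_minus degree_smult_le)
    then have lt: "degree (- smult (a * coeff (r d) k) (g d)) < degree (g k)"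
      using gk that Suc.prems(3) by linarith
    then have "degree (g' k) = D - k"
      using degree_add_eq_left[OF lt] gk unfolding g'_def by simp
    \<comment> \<open>Positive degree is what excludes \<open>g' k = 0\<close>.\<close>
    moreover have "D - k > 0" using that Suc.prems(3) by linarith
    ultimately show ?thesis by auto
  qed
  then obtain s where s: "\<And>k. k < d \<Longrightarrow> degree (s k) = D - k \<and> s k \<noteq> 0"
    "\<And>x t. (\<Sum>k<d. poly (s k) x * poly (r k) t) = (\<Sum>k<d. poly (g' k) x * t ^ k)"
    using Suc.IH[of g'] Suc.prems(1,3) by auto
  define s' where "s' = s(d := smult a (g d))"
  have "a \<noteq> 0" using lc by (simp add: a_def)
  then have "\<forall>k<Suc d. degree (s' k) = D - k \<and> s' k \<noteq> 0"
    using s(1) gd by (auto simp: s'_def less_Suc_eq)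
  moreover have "(\<Sum>k<Suc d. poly (s' k) x * poly (r k) t) = (\<Sum>k<Suc d. poly (g k) x * t ^ k)"
    for x t
  proof -
    have rd: "poly (r d) t = (\<Sum>k<d. coeff (r d) k * t ^ k) + lead_coeff (r d) * t ^ d"
      using lc by (simp add: poly_altdef lessThan_Suc_atMost[symmetric])
    have "(\<Sum>k<d. poly (s k) x * poly (r k) t)
        = (\<Sum>k<d. poly (g k) x * t ^ k) - a * poly (g d) x * (\<Sum>k<d. coeff (r d) k * t ^ k)"
      unfolding s(2) by (simp add: g'_def sum_subtractf sum_distrib_left algebra_simps)
    then show ?thesis using lc by (simp add: s'_def rd a_def algebra_simps)
  qed
  ultimately show ?case by blast
qed

text \<open>The binomial theorem. The coefficient of \<open>t ^ l\<close> has degree exactly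
  \<open>degree F - l\<close> in \<open>x\<close>, since its top term comes from the leading term of
  \<open>F\<close> alone and binomial coefficients do not vanish in characteristic 0.\<close>

lemma poly_diff_expansion:
  fixes F :: "'a::field_char_0 poly"
  assumes "F \<noteq> 0"
  shows "\<exists>g. (\<forall>l\<le>degree F. degree (g l) = degree F - l \<and> g l \<noteq> 0) \<and>
    (\<forall>x t. poly F (t - x) = (\<Sum>l\<le>degree F. poly (g l) x * t ^ l))"
proof -
  define d where "d = degree F"
  \<comment> \<open>The coefficient of \<open>x ^ (n - l) * t ^ l\<close> in the \<open>n\<close>-th
    term of \<open>F\<close> at \<open>t - x\<close>.\<close>
  define c where "c = (\<lambda>n l. coeff F n * of_nat (n choose l) * (- 1) ^ (n - l))"
  define g where "g = (\<lambda>l. \<Sum>n\<in>{l..d}. monom (c n l) (n - l))"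
  have coeff_g: "coeff (g l) (d - l) = c d l" if "l \<le> d" for l
  proof -
    have "coeff (g l) (d - l) = (\<Sum>n\<in>{l..d}. if n = d then c d l else 0)"
      unfolding g_def coeff_sum using that by (intro sum.cong) auto
    then show ?thesis using that by simp
  qed
  have "degree (g l) = d - l \<and> g l \<noteq> 0" if "l \<le> d" for l
  proof -
    have nz: "c d l \<noteq> 0" using assms that by (simp add: c_def d_def)
    have "degree (g l) \<le> d - l"
      unfolding g_def by (rule degree_sum_le) (auto intro: order.trans[OF degree_monom_le])
    moreover have "d - l \<le> degree (g l)" using coeff_g[OF that] nz by (intro le_degree) auto
    ultimately show ?thesis using coeff_g[OF that] nz by auto
  qed
  moreover have "poly F (t - x) = (\<Sum>l\<le>d. poly (g l) x * t ^ l)" for x t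
  proof -
    have "poly F (t - x) = (\<Sum>n\<le>d. coeff F n * (t + - x) ^ n)"
      by (simp add: poly_altdef d_def)
    also have "\<dots> = (\<Sum>n\<le>d. \<Sum>l\<le>n. c n l * x ^ (n - l) * t ^ l)"
      unfolding binomial_ring sum_distrib_left c_def
      by (intro sum.cong refl) (simp add: power_minus[of x] algebra_simps)
    also have "\<dots> = (\<Sum>l\<le>d. \<Sum>n\<in>{l..d}. c n l * x ^ (n - l) * t ^ l)"
      by (subst (1 2) sum.Sigma) (auto intro!: sum.reindex_bij_witness[of _ "\<lambda>(a, b). (b, a)" "\<lambda>(a, b). (b, a)"])
    also have "\<dots> = (\<Sum>l\<le>d. poly (g l) x * t ^ l)"
      by (simp add: g_def poly_sum poly_monom sum_distrib_right)
    finally show ?thesis .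
  qed
  ultimately show ?thesis unfolding d_def by blast
qed

subsection \<open>Dual families and Wronskian quotients\<close>

text \<open>If \<open>V\<close> has dimension \<open>N\<close>, this says that for every basis of
  \<open>V\<close> the matrix of values at any \<open>N\<close> consecutive points is
  invertible.\<close>

definition unisolvent :: "(complex \<Rightarrow> complex) set \<Rightarrow> nat \<Rightarrow> bool" where
  "unisolvent V N \<longleftrightarrow> (\<forall>f\<in>V. \<forall>x. (\<forall>j<N. f (x + of_nat j) = 0) \<longrightarrow> (\<forall>y. f y = 0))"

lemma unisolventD:
  "unisolvent V N \<Longrightarrow> f \<in> V \<Longrightarrow> (\<And>j. j < N \<Longrightarrow> f (x + of_nat j) = 0) \<Longrightarrow> f y = 0"
  unfolding unisolvent_def by blast

text \<open>If there are \<open>N\<close> functions and the matrix \<open>b k (x + of_nat j)\<close>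
  is invertible, the numbers \<open>\<psi> k x\<close> form row 0 of its inverse.\<close>

definition dual_family ::
  "nat \<Rightarrow> 'i set \<Rightarrow> ('i \<Rightarrow> complex \<Rightarrow> complex) \<Rightarrow> ('i \<Rightarrow> complex \<Rightarrow> complex) \<Rightarrow> bool" where
  "dual_family N K b \<psi> \<longleftrightarrow>
     (\<forall>x. \<forall>j<N. (\<Sum>k\<in>K. \<psi> k x * b k (x + of_nat j)) = (if j = 0 then 1 else 0))"

text \<open>
  If \<open>b = G b'\<close>, then \<open>\<psi>' = \<psi> G\<close>, and \<open>G\<close> vanishes on \<open>L \<times> (J - L')\<close>.
\<close>

lemma dual_family_in_span:
  assumes K: "finite K" "basis_family V K b" "dual_family N K b \<psi>" "L \<subseteq> K"
    and J: "finite J" "basis_family V J b'" "dual_family N J b' \<psi>'" "L' \<subseteq> J"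
    and "unisolvent V N" "b ` L \<subseteq> cfun.span (b' ` L')" "a \<in> J - L'"
  shows "\<psi>' a \<in> cfun.span (\<psi> ` (K - L))"
proof -
  have "\<exists>c. (\<forall>x. b k x = (\<Sum>a\<in>J. c a * b' a x)) \<and> (k \<in> L \<longrightarrow> (\<forall>a\<in>J - L'. c a = 0))"
    if "k \<in> K" for k
  proof (cases "k \<in> L")
    case True
    have fL: "finite L'" using J(1,4) by (rule finite_subset[rotated])
    obtain c where c: "\<And>x. b k x = (\<Sum>a\<in>L'. c a * b' a x)"
      using span_family_iff[OF fL] assms(10) True by blast
    have "(\<Sum>a\<in>J. (if a \<in> L' then c a else 0) * b' a x) = (\<Sum>a\<in>L'. c a * b' a x)" for x
      using J(1,4) by (intro sum.mono_neutral_cong_right) auto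
    then show ?thesis using c by (intro exI[of _ "\<lambda>a. if a \<in> L' then c a else 0"]) auto
  next
    case False
    have "b k \<in> cfun.span (b' ` J)"
      using K(2) J(2) that by (auto simp: basis_family_def intro: cfun.span_base)
    then show ?thesis using span_family_iff[OF J(1)] False by blast
  qed
  then obtain G where G: "\<And>k x. k \<in> K \<Longrightarrow> b k x = (\<Sum>a\<in>J. G k a * b' a x)"
    "\<And>k a. k \<in> L \<Longrightarrow> a \<in> J - L' \<Longrightarrow> G k a = 0"
    using K(4) by (metis subsetD)
  have "\<psi>' a x = (\<Sum>k\<in>K - L. G k a * \<psi> k x)" for x
  proof -
    \<comment> \<open>With \<open>x\<close> fixed, the numbers \<open>s a\<close> are coefficients
      of a function in \<open>V\<close>. It vanishes at \<open>x, ..., x + N - 1\<close> because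
      both dual families produce the same delta; unisolvence and independence then give
      \<open>s a = 0\<close>.\<close>
    define s where "s = (\<lambda>a. \<psi>' a x - (\<Sum>k\<in>K. \<psi> k x * G k a))"
    have "(\<Sum>a\<in>J. s a * b' a y) = (\<Sum>a\<in>J. \<psi>' a x * b' a y) - (\<Sum>k\<in>K. \<psi> k x * b k y)" for y
    proof -
      have "(\<Sum>k\<in>K. \<psi> k x * b k y) = (\<Sum>k\<in>K. \<Sum>a\<in>J. \<psi> k x * G k a * b' a y)"
        using G(1) by (simp add: sum_distrib_left mult.assoc)
      also have "\<dots> = (\<Sum>a\<in>J. (\<Sum>k\<in>K. \<psi> k x * G k a) * b' a y)"
        by (subst sum.swap) (simp add: sum_distrib_right)
      finally show ?thesis by (simp add: s_def left_diff_distrib sum_subtractf)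
    qed
    then have "(\<Sum>a\<in>J. s a * b' a (x + of_nat j)) = 0" if "j < N" for j
      using that K(3) J(3) by (simp add: dual_family_def)
    moreover have "(\<lambda>y. \<Sum>a\<in>J. s a * b' a y) \<in> V"
      using J(1,2) span_family_iff[of J _ b'] by (auto simp: basis_family_def)
    ultimately have "(\<Sum>a\<in>J. s a * b' a y) = 0" for y
      using unisolventD[OF assms(9), of "\<lambda>y. \<Sum>a\<in>J. s a * b' a y" x y] by simp
    then have "s a = 0" using basis_familyD[OF J(2,1), of s a] assms(11) by simp
    then have "\<psi>' a x = (\<Sum>k\<in>K. G k a * \<psi> k x)" by (simp add: s_def mult.commute)
    also have "\<dots> = (\<Sum>k\<in>K - L. G k a * \<psi> k x)"
      using K(1) G(2) assms(11) by (intro sum.mono_neutral_right) auto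
    finally show ?thesis .
  qed
  then show ?thesis
    using K(1) by (subst span_family_iff) (auto intro!: exI[of _ "\<lambda>k. G k a"])
qed

text \<open>The inclusion applied in both directions. This gives the independence of
  \<open>Q(W)\<close> from the bases and allows its computation in a convenient one.\<close>

corollary span_dual_family_eq:
  assumes "finite K" "basis_family V K b" "dual_family N K b \<psi>" "L \<subseteq> K"
    and "finite J" "basis_family V J b'" "dual_family N J b' \<psi>'" "L' \<subseteq> J"
    and "unisolvent V N" "cfun.span (b ` L) = cfun.span (b' ` L')"
  shows "cfun.span (\<psi> ` (K - L)) = cfun.span (\<psi>' ` (J - L'))"
proof -
  have "b ` L \<subseteq> cfun.span (b' ` L')" "b' ` L' \<subseteq> cfun.span (b ` L)"
    using assms(10) cfun.span_superset by blast+
  then have "\<psi>' ` (J - L') \<subseteq> cfun.span (\<psi> ` (K - L))"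
    "\<psi> ` (K - L) \<subseteq> cfun.span (\<psi>' ` (J - L'))"
    using dual_family_in_span[OF assms(1-9)] dual_family_in_span[OF assms(5-8,1-4,9)]
    by (simp_all add: image_subset_iff)
  then show ?thesis by (simp add: cfun.span_eq)
qed

section \<open>Casorati matrices, whose determinants are the discrete Wronskians\<close>

definition casorati :: "(complex \<Rightarrow> complex) list \<Rightarrow> complex \<Rightarrow> complex mat" where
  "casorati bs x = mat (length bs) (length bs) (\<lambda>(i, j). (bs ! i) (x + of_nat j))"

lemma casorati_carrier: "casorati bs x \<in> carrier_mat (length bs) (length bs)"
  by (simp add: casorati_def)

lemma shift_funpow: "(shift ^^ j) f x = f (x + of_nat j)"
  by (induction j arbitrary: f x) (auto simp: shift_def funpow_swap1 algebra_simps)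

lemma dwronskian_eq: "dwronskian bs x = det (casorati bs x)"
  by (simp add: dwronskian_def casorati_def shift_funpow)

text \<open>A kernel vector of the transpose is a nontrivial combination of the basis vanishing at
  \<open>length bs\<close> consecutive points. By unisolvence it is zero everywhere, against
  independence.\<close>

lemma det_casorati_nonzero:
  assumes "basis_list V bs" "unisolvent V (length bs)"
  shows "det (casorati bs x) \<noteq> 0"
proof
  let ?N = "length bs" and ?A = "casorati bs x"
  assume "det ?A = 0"
  then have "det (transpose_mat ?A) = 0" by (simp add: det_transpose[OF casorati_carrier])
  then obtain v where v: "v \<in> carrier_vec ?N" "v \<noteq> 0\<^sub>v ?N" "transpose_mat ?A *\<^sub>v v = 0\<^sub>v ?N"
    using det_0_iff_vec_prod_zero_field[of "transpose_mat ?A" ?N]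
    by (auto simp: casorati_def)
  have "(\<Sum>i<?N. v $ i * (bs ! i) (x + of_nat j)) = 0" if "j < ?N" for j
  proof -
    have "(transpose_mat ?A *\<^sub>v v) $ j = (\<Sum>i<?N. v $ i * (bs ! i) (x + of_nat j))"
      using that v(1) by (auto simp: casorati_def scalar_prod_def lessThan_atLeast0 intro!: sum.cong)
    then show ?thesis using v that by simp
  qed
  moreover have "(\<lambda>y. \<Sum>i<?N. v $ i * (bs ! i) y) \<in> V"
    using assms(1) span_family_iff[of "{..<?N}" _ "(!) bs"]
    by (auto simp: basis_list_def basis_family_def)
  ultimately have "(\<Sum>i<?N. v $ i * (bs ! i) y) = 0" for y
    using unisolventD[OF assms(2), of "\<lambda>y. \<Sum>i<?N. v $ i * (bs ! i) y" x y] by simp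
  then have "v $ i = 0" if "i < ?N" for i
    using basis_familyD[of V "{..<?N}" "(!) bs" "($) v" i] assms(1) that by (auto simp: basis_list_def)
  then show False using v(1,2) by auto
qed

text \<open>The shift acts on a shift-invariant space by a constant matrix, whose determinant is
  \<open>\<kappa>\<close>. This moves the denominator of \<open>Q_gen\<close> from
  \<open>x + 1\<close> back to \<open>x\<close>.\<close>

lemma casorati_shift:
  assumes "basis_list V bs" "\<And>f. f \<in> V \<Longrightarrow> shift f \<in> V"
  shows "\<exists>\<kappa>. \<forall>x. det (casorati bs (x + 1)) = \<kappa> * det (casorati bs x)"
proof -
  let ?N = "length bs"
  have "\<exists>c. \<forall>x. (bs ! i) (x + 1) = (\<Sum>k<?N. c k * (bs ! k) x)" if "i < ?N" for i
  proof -
    have "bs ! i \<in> V"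
      using assms(1) that by (auto simp: basis_list_def basis_family_def intro!: cfun.span_base)
    then have "shift (bs ! i) \<in> cfun.span ((!) bs ` {..<?N})"
      using assms by (auto simp: basis_list_def basis_family_def)
    then show ?thesis using span_family_iff[of "{..<?N}" "shift (bs ! i)" "(!) bs"]
      by (simp add: shift_def)
  qed
  then obtain S where S: "\<And>i x. i < ?N \<Longrightarrow> (bs ! i) (x + 1) = (\<Sum>k<?N. S i k * (bs ! k) x)"
    by metis
  define B where "B = mat ?N ?N (\<lambda>(i, k). S i k)"
  have B: "B \<in> carrier_mat ?N ?N" by (simp add: B_def)
  have "casorati bs (x + 1) = B * casorati bs x" for x
  proof (rule eq_matI)
    fix i j assume "i < dim_row (B * casorati bs x)" "j < dim_col (B * casorati bs x)"
    then have ij: "i < ?N" "j < ?N" by (auto simp: B_def casorati_def)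
    have "x + 1 + of_nat j = (x + of_nat j) + 1" by simp
    then have "(bs ! i) (x + 1 + of_nat j) = (\<Sum>k<?N. S i k * (bs ! k) (x + of_nat j))"
      using S[OF ij(1)] by metis
    then show "casorati bs (x + 1) $$ (i, j) = (B * casorati bs x) $$ (i, j)"
      using ij by (auto simp: B_def casorati_def scalar_prod_def lessThan_atLeast0 intro!: sum.cong)
  qed (auto simp: B_def casorati_def)
  then show ?thesis using det_mult[OF B casorati_carrier] by auto
qed

text \<open>Cramer's rule. Omitting one function and column 0 from the Casorati matrix at
  \<open>x\<close> leaves the Casorati matrix of the other functions at \<open>x + 1\<close>, which
  is the numerator after the outer shift in \<open>Q_gen\<close>.\<close>

lemma Q_gen_dual_family:
  assumes bs: "basis_list V (fs @ hs)" and uni: "unisolvent V (length (fs @ hs))"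
    and sh: "\<And>f. f \<in> V \<Longrightarrow> shift f \<in> V"
  shows "\<exists>\<psi>. dual_family (length (fs @ hs)) {..<length (fs @ hs)} ((!) (fs @ hs)) \<psi> \<and>
    cfun.span (Q_gen fs hs ` {..<length hs}) =
      cfun.span (\<psi> ` ({..<length (fs @ hs)} - {..<length fs}))"
proof -
  define B N where "B = fs @ hs" and "N = length B"
  define D where "D x = det (casorati B x)" for x
  have D0: "D x \<noteq> 0" for x
    using det_casorati_nonzero[OF bs uni] by (simp add: D_def B_def)
  obtain \<kappa> where \<kappa>: "\<And>x. D (x + 1) = \<kappa> * D x"
    using casorati_shift[OF bs sh] by (auto simp: D_def B_def)
  have "\<kappa> \<noteq> 0" using \<kappa>[of 0] D0[of 1] by auto
  \<comment> \<open>Row 0 of the inverse matrix. Duality is row 0 of the identity that the adjugate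
    times the matrix is the determinant times 1.\<close>
  define \<psi> where "\<psi> a x = cofactor (casorati B x) a 0 / D x" for a x
  have dual: "dual_family N {..<N} ((!) B) \<psi>"
    unfolding dual_family_def
  proof (intro allI impI)
    fix x j assume j: "j < N"
    let ?A = "casorati B x"
    have A: "?A \<in> carrier_mat N N" unfolding N_def by (rule casorati_carrier)
    have entry: "?A $$ (a, j) = (B ! a) (x + of_nat j)" if "a < N" for a
      using that j by (simp add: casorati_def N_def)
    have "(if j = 0 then D x else 0) = (adj_mat ?A * ?A) $$ (0, j)"
      using j unfolding adj_mat(3)[OF A] by (auto simp: D_def)
    also have "\<dots> = (\<Sum>a<N. cofactor ?A a 0 * ?A $$ (a, j))"
      using j A by (auto simp: adj_mat_def scalar_prod_def lessThan_atLeast0)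
    also have "\<dots> = (\<Sum>a<N. cofactor ?A a 0 * (B ! a) (x + of_nat j))"
      by (simp add: entry)
    finally have "(\<Sum>a<N. cofactor ?A a 0 * (B ! a) (x + of_nat j)) = (if j = 0 then D x else 0)"
      by (rule sym)
    moreover have "(\<Sum>a<N. \<psi> a x * (B ! a) (x + of_nat j))
        = (\<Sum>a<N. cofactor ?A a 0 * (B ! a) (x + of_nat j)) / D x"
      by (simp add: \<psi>_def sum_divide_distrib)
    ultimately show "(\<Sum>a<N. \<psi> a x * (B ! a) (x + of_nat j)) = (if j = 0 then 1 else 0)"
      using D0[of x] by simp
  qed
  \<comment> \<open>The sign comes from the cofactor, the factor \<open>inverse \<kappa>\<close>
    from the denominator evaluated at \<open>x + 1\<close>.\<close>
  define c where "c a = inverse \<kappa> * (- 1) ^ (length fs + a)" for a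
  have Q: "Q_gen fs hs a = cscale (c a) (\<psi> (length fs + a))" if a: "a < length hs" for a
  proof
    fix x
    define bs' where "bs' = fs @ take a hs @ drop (Suc a) hs"
    have len: "N = Suc (length bs')" using a by (simp add: N_def B_def bs'_def)
    have nth: "bs' ! i = (if i < length fs + a then B ! i else B ! Suc i)" if "i < length bs'" for i
      using that a by (auto simp: bs'_def B_def nth_append Suc_diff_le)
    have "mat_delete (casorati B x) (length fs + a) 0 = casorati bs' (x + 1)"
    proof (rule eq_matI)
      fix i j assume "i < dim_row (casorati bs' (x + 1))" "j < dim_col (casorati bs' (x + 1))"
      then have ij: "i < length bs'" "j < length bs'" by (auto simp: casorati_def)
      have "x + of_nat (Suc j) = x + 1 + of_nat j" by simp
      then show "mat_delete (casorati B x) (length fs + a) 0 $$ (i, j) = casorati bs' (x + 1) $$ (i, j)"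
        using ij len[unfolded N_def] by (simp add: mat_delete_def casorati_def nth add.assoc)
    qed (simp_all add: mat_delete_def casorati_def len[unfolded N_def])
    then have "dwronskian bs' (x + 1)
        = (- 1) ^ (length fs + a) * cofactor (casorati B x) (length fs + a) 0"
      by (simp add: dwronskian_eq cofactor_def)
    moreover have "dwronskian B (x + 1) = \<kappa> * D x" using \<kappa> by (simp add: dwronskian_eq D_def)
    ultimately have "Q_gen fs hs a x
        = (- 1) ^ (length fs + a) * cofactor (casorati B x) (length fs + a) 0 / (\<kappa> * D x)"
      by (simp add: Q_gen_def shift_def bs'_def B_def)
    then show "Q_gen fs hs a x = cscale (c a) (\<psi> (length fs + a)) x"
      by (simp add: cscale_def c_def \<psi>_def divide_inverse)
  qed
  have idx: "{..<N} - {..<length fs} = (\<lambda>a. length fs + a) ` {..<length hs}"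
  proof (intro equalityI subsetI)
    fix y assume "y \<in> {..<N} - {..<length fs}"
    then show "y \<in> (\<lambda>a. length fs + a) ` {..<length hs}"
      by (intro image_eqI[of _ _ "y - length fs"]) (auto simp: N_def B_def)
  qed (auto simp: N_def B_def)
  have c0: "c a \<noteq> 0" for a using \<open>\<kappa> \<noteq> 0\<close> by (simp add: c_def)
  have "cfun.span (Q_gen fs hs ` {..<length hs}) = cfun.span (\<psi> ` ({..<N} - {..<length fs}))"
    unfolding cfun.span_eq
  proof (intro conjI subsetI)
    fix g assume "g \<in> Q_gen fs hs ` {..<length hs}"
    then obtain a where "a < length hs" "g = cscale (c a) (\<psi> (length fs + a))" using Q by auto
    then show "g \<in> cfun.span (\<psi> ` ({..<N} - {..<length fs}))"
      unfolding idx by (simp add: cfun.span_scale cfun.span_base)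
  next
    fix g assume "g \<in> \<psi> ` ({..<N} - {..<length fs})"
    then obtain a where a: "a < length hs" "g = \<psi> (length fs + a)" unfolding idx by auto
    then have "g = cscale (inverse (c a)) (Q_gen fs hs a)"
      using c0[of a] Q[OF a(1)] by (simp add: cscale_def flip: mult.assoc)
    then show "g \<in> cfun.span (Q_gen fs hs ` {..<length hs})"
      using a(1) by (simp add: cfun.span_scale cfun.span_base)
  qed
  then show ?thesis using dual unfolding N_def B_def by (intro exI[of _ \<psi>]) simp
qed

subsection \<open>Spaces of quasi-exponentials\<close>

lemma cpow_nonzero [simp]: "cpow lg a x \<noteq> 0"
  by (simp add: cpow_def)

lemma cpow_uminus: "cpow lg a (- x) = inverse (cpow lg a x)"
  by (simp add: cpow_def exp_minus)

lemma cpow_add: "cpow lg a (x + y) = cpow lg a x * cpow lg a y"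
  by (simp add: cpow_def distrib_right exp_add)

text \<open>At natural numbers the branch of the logarithm disappears, which makes the purely
  algebraic \<open>exp_poly_eq_0\<close> applicable.\<close>

lemma cpow_of_nat:
  assumes "log_branch lg" "a \<noteq> 0"
  shows "cpow lg a (of_nat j) = a ^ j"
  using assms by (simp add: cpow_def log_branch_def exp_of_nat_mult)

text \<open>Vanishing coefficients replace a degree bound so that \<open>p i = 0\<close> forces
  \<open>F i = 0\<close>. The space agrees with \<open>W_hat\<close> for the \<open>p i\<close> used
  there.\<close>

definition quasi_exp_space ::
  "(complex \<Rightarrow> complex) \<Rightarrow> 'i set \<Rightarrow> ('i \<Rightarrow> complex) \<Rightarrow> ('i \<Rightarrow> nat) \<Rightarrow> (complex \<Rightarrow> complex) set" where
  "quasi_exp_space lg I \<alpha> p =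
     {f. \<exists>F. (\<forall>i\<in>I. \<forall>k\<ge>p i. coeff (F i) k = 0) \<and>
       (\<forall>x. f x = (\<Sum>i\<in>I. cpow lg (\<alpha> i) x * poly (F i) x))}"

lemma unisolvent_quasi_exp_space:
  fixes \<alpha> :: "'i \<Rightarrow> complex"
  assumes "log_branch lg" "finite I" "inj_on \<alpha> I" "\<And>i. i \<in> I \<Longrightarrow> \<alpha> i \<noteq> 0"
  shows "unisolvent (quasi_exp_space lg I \<alpha> p) (sum p I)"
  unfolding unisolvent_def
proof (intro ballI allI impI)
  fix f x y
  assume "f \<in> quasi_exp_space lg I \<alpha> p" and f0: "\<forall>j<sum p I. f (x + of_nat j) = 0"
  then obtain F where F: "\<And>i k. i \<in> I \<Longrightarrow> p i \<le> k \<Longrightarrow> coeff (F i) k = 0"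
    and f: "\<And>x. f x = (\<Sum>i\<in>I. cpow lg (\<alpha> i) x * poly (F i) x)"
    by (auto simp: quasi_exp_space_def)
  \<comment> \<open>The starting point \<open>x\<close> is fixed, so its exponential factors are
    constants and can be absorbed into the polynomials.\<close>
  define G where "G i = smult (cpow lg (\<alpha> i) x) (F i)" for i
  have "G i = 0" if "i \<in> I" for i
  proof (rule exp_poly_eq_0[OF assms(2,3,4) _ _ that, of p G x])
    fix j assume "j < sum p I"
    have "(\<Sum>i\<in>I. \<alpha> i ^ j * poly (G i) (x + of_nat j)) = f (x + of_nat j)"
      unfolding f using assms(1,4) by (intro sum.cong) (simp_all add: G_def cpow_add cpow_of_nat)
    then show "(\<Sum>i\<in>I. \<alpha> i ^ j * poly (G i) (x + of_nat j)) = 0"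
      using f0 \<open>j < sum p I\<close> by simp
  qed (use F in \<open>auto simp: G_def\<close>)
  then have "F i = 0" if "i \<in> I" for i using that by (simp add: G_def)
  then show "f y = 0" by (simp add: f)
qed

lemma shift_quasi_exp_space:
  assumes "log_branch lg" "\<And>i. i \<in> I \<Longrightarrow> \<alpha> i \<noteq> 0" "f \<in> quasi_exp_space lg I \<alpha> p"
  shows "shift f \<in> quasi_exp_space lg I \<alpha> p"
proof -
  obtain F where F: "\<And>i k. i \<in> I \<Longrightarrow> p i \<le> k \<Longrightarrow> coeff (F i) k = 0"
    and f: "\<And>x. f x = (\<Sum>i\<in>I. cpow lg (\<alpha> i) x * poly (F i) x)"
    using assms(3) by (auto simp: quasi_exp_space_def)
  define G where "G i = smult (\<alpha> i) (F i \<circ>\<^sub>p [:1, 1:])" for i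
  have "shift f x = (\<Sum>i\<in>I. cpow lg (\<alpha> i) x * poly (G i) x)" for x
    unfolding shift_def f
    using assms(1,2) cpow_of_nat[of lg _ 1]
    by (intro sum.cong) (simp_all add: G_def cpow_add poly_pcompose add.commute)
  moreover have "coeff (G i) k = 0" if "i \<in> I" "p i \<le> k" for i k
    using coeff_pcompose_shift[of "p i" "F i" k 1] F that by (simp add: G_def)
  ultimately show ?thesis unfolding quasi_exp_space_def by blast
qed

section \<open>Independent families and bases of quasi-exponentials\<close>

lemma independent_distinct_degrees:
  fixes r :: "'i \<Rightarrow> 'a::field poly"
  assumes "finite K" "inj_on (\<lambda>k. degree (r k)) K" "\<And>k. k \<in> K \<Longrightarrow> r k \<noteq> 0"
    and "(\<Sum>k\<in>K. smult (c k) (r k)) = 0" "k \<in> K"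
  shows "c k = 0"
proof (rule ccontr)
  assume "c k \<noteq> 0"
  define S where "S = {k \<in> K. c k \<noteq> 0}"
  have "finite S" "S \<noteq> {}" using assms \<open>c k \<noteq> 0\<close> by (auto simp: S_def)
  \<comment> \<open>The largest degree carrying a nonzero coefficient is attained only once, so
    nothing can cancel it.\<close>
  define m where "m = Max ((\<lambda>k. degree (r k)) ` S)"
  have "m \<in> (\<lambda>k. degree (r k)) ` S"
    unfolding m_def using \<open>finite S\<close> \<open>S \<noteq> {}\<close> by (intro Max_in) auto
  then obtain l where l: "l \<in> S" "m = degree (r l)" by blast
  have "c i * coeff (r i) m = 0" if "i \<in> K - {l}" for i
  proof (cases "c i = 0")
    case False
    then have "degree (r i) \<le> m" using that \<open>finite S\<close> by (auto simp: m_def S_def)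
    moreover have "degree (r i) \<noteq> m" using assms(2) that l by (auto simp: S_def dest: inj_onD)
    ultimately show ?thesis by (simp add: coeff_eq_0)
  qed simp
  then have "(\<Sum>i\<in>K - {l}. c i * coeff (r i) m) = 0" by (intro sum.neutral) blast
  then have "(\<Sum>i\<in>K. c i * coeff (r i) m) = c l * coeff (r l) m"
    using assms(1) l sum.remove[of K l "\<lambda>i. c i * coeff (r i) m"] by (simp add: S_def)
  moreover have "(\<Sum>i\<in>K. c i * coeff (r i) m) = coeff (\<Sum>k\<in>K. smult (c k) (r k)) m"
    by (simp add: coeff_sum)
  ultimately have "c l * lead_coeff (r l) = 0" using assms(4) l by simp
  then show False using l assms(3) by (auto simp: S_def)
qed

text \<open>The factors \<open>g i\<close> are prescribed only at natural numbers, so the lemma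
  serves both \<open>\<alpha> i\<close> with exponent \<open>x\<close> and, through
  \<open>\<beta> i = inverse (\<alpha> i)\<close>, exponent \<open>- x\<close>.\<close>

lemma independent_quasi_exp:
  fixes \<beta> :: "'i \<Rightarrow> complex"
  assumes "finite I" "inj_on \<beta> I" "\<And>i. i \<in> I \<Longrightarrow> \<beta> i \<noteq> 0"
    and "\<And>i j. i \<in> I \<Longrightarrow> g i (of_nat j) = \<beta> i ^ j"
    and "\<And>i. i \<in> I \<Longrightarrow> finite (K i)" "\<And>i. i \<in> I \<Longrightarrow> inj_on (\<lambda>k. degree (r i k)) (K i)"
    and "\<And>i k. i \<in> I \<Longrightarrow> k \<in> K i \<Longrightarrow> r i k \<noteq> 0"
  shows "inj_on (\<lambda>(i, k) x. g i x * poly (r i k) x) (Sigma I K) \<and>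
    cfun.independent ((\<lambda>(i, k) x. g i x * poly (r i k) x) ` Sigma I K)"
proof (subst independent_family_iff)
  show "finite (Sigma I K)" using assms(1,5) by auto
  show "\<forall>c. (\<forall>x. (\<Sum>\<kappa>\<in>Sigma I K. c \<kappa> * (case \<kappa> of (i, k) \<Rightarrow> \<lambda>x. g i x * poly (r i k) x) x) = 0)
      \<longrightarrow> (\<forall>\<kappa>\<in>Sigma I K. c \<kappa> = 0)"
  proof (intro allI impI ballI)
    fix c \<kappa> assume c: "\<forall>x. (\<Sum>\<kappa>\<in>Sigma I K. c \<kappa> * (case \<kappa> of (i, k) \<Rightarrow> \<lambda>x. g i x * poly (r i k) x) x) = 0"
      and \<kappa>: "\<kappa> \<in> Sigma I K"
    obtain i k where ik: "\<kappa> = (i, k)" "i \<in> I" "k \<in> K i" using \<kappa> by auto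
    define F where "F i = (\<Sum>k\<in>K i. smult (c (i, k)) (r i k))" for i
    have sum: "(\<Sum>i\<in>I. g i x * poly (F i) x) = 0" for x
    proof -
      have "(\<Sum>i\<in>I. g i x * poly (F i) x) = (\<Sum>i\<in>I. \<Sum>k\<in>K i. c (i, k) * (g i x * poly (r i k) x))"
        by (simp add: F_def poly_sum sum_distrib_left mult.left_commute)
      also have "\<dots> = (\<Sum>(i, k)\<in>Sigma I K. c (i, k) * (g i x * poly (r i k) x))"
        using assms(1,5) by (intro sum.Sigma) auto
      also have "\<dots> = (\<Sum>\<kappa>\<in>Sigma I K. c \<kappa> * (case \<kappa> of (i, k) \<Rightarrow> \<lambda>x. g i x * poly (r i k) x) x)"
        by (intro sum.cong) auto
      finally show ?thesis using c by simp
    qed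
    have "F i = 0"
    proof (rule exp_poly_eq_0[OF assms(1,2,3) _ _ ik(2), of "\<lambda>i. Suc (degree (F i))" F 0])
      fix j
      have "(\<Sum>i\<in>I. \<beta> i ^ j * poly (F i) (0 + of_nat j)) = (\<Sum>i\<in>I. g i (of_nat j) * poly (F i) (of_nat j))"
        using assms(4) by simp
      then show "(\<Sum>i\<in>I. \<beta> i ^ j * poly (F i) (0 + of_nat j)) = 0" using sum by simp
    qed (auto intro: coeff_eq_0)
    then show "c \<kappa> = 0"
      using independent_distinct_degrees[of "K i" "r i" "\<lambda>k. c (i, k)" k] assms(5-7) ik
      by (simp add: F_def)
  qed
qed

text \<open>Any choice of one polynomial in each degree below \<open>p i\<close> will do: monomials
  describe \<open>W_hat\<close>, and a completion of the given \<open>q i j\<close> produces a basis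
  adapted to \<open>W\<close>.\<close>

lemma basis_quasi_exp_space:
  fixes \<alpha> :: "'i \<Rightarrow> complex"
  assumes "log_branch lg" "finite I" "inj_on \<alpha> I" "\<And>i. i \<in> I \<Longrightarrow> \<alpha> i \<noteq> 0"
    and r: "\<And>i k. i \<in> I \<Longrightarrow> k < p i \<Longrightarrow> degree (r i k) = k \<and> r i k \<noteq> 0"
  shows "basis_family (quasi_exp_space lg I \<alpha> p) (SIGMA i:I. {..<p i})
    (\<lambda>(i, k) x. cpow lg (\<alpha> i) x * poly (r i k) x)"
proof -
  define K where "K = (SIGMA i:I. {..<p i})"
  define b where "b = (\<lambda>(i, k) x. cpow lg (\<alpha> i) x * poly (r i k) x)"
  have fK: "finite K" using assms(2) by (auto simp: K_def)
  have indep: "inj_on b K \<and> cfun.independent (b ` K)"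
    unfolding K_def b_def
    using assms by (intro independent_quasi_exp[of I \<alpha>]) (auto simp: cpow_of_nat inj_on_def)
  have combination: "(\<Sum>\<kappa>\<in>K. c \<kappa> * b \<kappa> x)
      = (\<Sum>i\<in>I. cpow lg (\<alpha> i) x * poly (\<Sum>k<p i. smult (c (i, k)) (r i k)) x)" for c x
  proof -
    have "(\<Sum>i\<in>I. cpow lg (\<alpha> i) x * poly (\<Sum>k<p i. smult (c (i, k)) (r i k)) x)
        = (\<Sum>i\<in>I. \<Sum>k<p i. c (i, k) * b (i, k) x)"
      by (simp add: b_def poly_sum sum_distrib_left mult.left_commute)
    also have "\<dots> = (\<Sum>(i, k)\<in>K. c (i, k) * b (i, k) x)"
      unfolding K_def using assms(2) by (intro sum.Sigma) auto
    finally show ?thesis by (simp add: case_prod_unfold)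
  qed
  have "f \<in> cfun.span (b ` K) \<longleftrightarrow> f \<in> quasi_exp_space lg I \<alpha> p" for f
  proof
    assume "f \<in> cfun.span (b ` K)"
    then obtain c where c: "\<And>x. f x = (\<Sum>\<kappa>\<in>K. c \<kappa> * b \<kappa> x)"
      using span_family_iff[OF fK] by blast
    have "coeff (\<Sum>k<p i. smult (c (i, k)) (r i k)) l = 0" if "i \<in> I" "p i \<le> l" for i l
      using r[OF that(1)] that(2) by (auto simp: coeff_sum intro!: sum.neutral coeff_eq_0)
    then show "f \<in> quasi_exp_space lg I \<alpha> p"
      unfolding quasi_exp_space_def mem_Collect_eq c combination
      by (intro exI[of _ "\<lambda>i. \<Sum>k<p i. smult (c (i, k)) (r i k)"]) simp
  next
    assume "f \<in> quasi_exp_space lg I \<alpha> p"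
    then obtain F where F: "\<And>i k. i \<in> I \<Longrightarrow> p i \<le> k \<Longrightarrow> coeff (F i) k = 0"
      and f: "\<And>x. f x = (\<Sum>i\<in>I. cpow lg (\<alpha> i) x * poly (F i) x)"
      by (auto simp: quasi_exp_space_def)
    have "\<exists>c. F i = (\<Sum>k<p i. smult (c k) (r i k))" if "i \<in> I" for i
      using triangular_expansion[of "p i" "r i" "F i"] r F that by blast
    then obtain c where c: "\<And>i. i \<in> I \<Longrightarrow> F i = (\<Sum>k<p i. smult (c i k) (r i k))" by metis
    have "f x = (\<Sum>\<kappa>\<in>K. (\<lambda>(i, k). c i k) \<kappa> * b \<kappa> x)" for x
      unfolding combination f by (simp add: c)
    then show "f \<in> cfun.span (b ` K)" using span_family_iff[OF fK, of f b] by blast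
  qed
  then show ?thesis
    using indep unfolding K_def[symmetric] b_def[symmetric] basis_family_def by blast
qed

lemma W_hat_eq:
  assumes "log_branch lg" "inj_on \<alpha> {1..n}" "\<And>i. i \<in> {1..n} \<Longrightarrow> \<alpha> i \<noteq> 0"
  shows "W_hat lg n \<alpha> \<mu> = quasi_exp_space lg {1..n} \<alpha> (\<lambda>i. \<mu> i 1 + conj_part (\<mu> i) 1)"
proof -
  let ?p = "\<lambda>i. \<mu> i 1 + conj_part (\<mu> i) 1"
  have "{(\<lambda>x. cpow lg (\<alpha> i) x * x ^ p) | i p. i \<in> {1..n} \<and> p < ?p i}
      = (\<lambda>(i, k) x. cpow lg (\<alpha> i) x * poly (monom 1 k) x) ` (SIGMA i:{1..n}. {..<?p i})"
    by (auto simp: poly_monom image_iff) blast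
  moreover have "basis_family (quasi_exp_space lg {1..n} \<alpha> ?p) (SIGMA i:{1..n}. {..<?p i})
      (\<lambda>(i, k) x. cpow lg (\<alpha> i) x * poly (monom 1 k) x)"
    using assms by (intro basis_quasi_exp_space) (auto simp: degree_monom_eq)
  ultimately show ?thesis unfolding W_hat_def basis_family_def by simp
qed

lemma basis_family_cong:
  assumes "\<And>k. k \<in> K \<Longrightarrow> b k = b' k"
  shows "basis_family V K b = basis_family V K b'"
  using assms unfolding basis_family_def by (simp cong: inj_on_cong image_cong)

lemma basis_list_map:
  assumes "basis_family V K b" "distinct ks" "set ks = K"
  shows "basis_list V (map b ks)"
proof -
  have "basis_family V {..<length ks} (b \<circ> (!) ks)"
    using assms by (intro basis_family_reindex[OF bij_betw_nth]) auto
  then show ?thesis unfolding basis_list_def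
    by (subst basis_family_cong[of _ _ "b \<circ> (!) ks"]) auto
qed

text \<open>
  Polynomials \<open>F i\<close> with \<open>\<Sum>i. \<alpha> i ^ j * F i j = \<delta>\<^bsub>j0\<^esub>\<close> have maximal degree: otherwise their
  quasi-exponential would lie in a space of dimension \<open>N - 1\<close> and vanish at \<open>1, \<dots>, N - 1\<close>.
\<close>

lemma exists_delta_quasi_exp:
  fixes \<alpha> :: "'i \<Rightarrow> complex"
  assumes "log_branch lg" "finite I" "inj_on \<alpha> I" "\<And>i. i \<in> I \<Longrightarrow> \<alpha> i \<noteq> 0"
    and "\<And>i. i \<in> I \<Longrightarrow> p i > 0"
  shows "\<exists>F. (\<forall>i\<in>I. degree (F i) = p i - 1 \<and> F i \<noteq> 0) \<and>
    (\<forall>j<sum p I. (\<Sum>i\<in>I. \<alpha> i ^ j * poly (F i) (of_nat j)) = (if j = 0 then 1 else 0))"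
proof -
  define V where "V = quasi_exp_space lg I \<alpha> p"
  define K where "K = (SIGMA i:I. {..<p i})"
  have fK: "finite K" and cK: "card K = sum p I" using assms(2) by (auto simp: K_def)
  define b where "b = (\<lambda>(i, k) x. cpow lg (\<alpha> i) x * poly (monom 1 k) x)"
  have bV: "basis_family V K b"
    unfolding V_def K_def b_def using assms
    by (intro basis_quasi_exp_space) (auto simp: degree_monom_eq)
  obtain ks where ks: "set ks = K" "distinct ks" using fK finite_distinct_list by blast
  define bs where "bs = map b ks"
  have bs: "basis_list V bs" unfolding bs_def by (rule basis_list_map[OF bV ks(2,1)])
  have len: "length bs = sum p I" using ks cK distinct_card by (fastforce simp: bs_def)
  \<comment> \<open>With the empty list for \<open>W\<close>, only the existence of a dual family is
    extracted.\<close>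
  obtain \<psi> where \<psi>: "dual_family (length bs) {..<length bs} ((!) bs) \<psi>"
    using Q_gen_dual_family[of V "[]" bs] bs len assms(1-4)
    by (auto simp: V_def unisolvent_quasi_exp_space shift_quasi_exp_space)
  \<comment> \<open>Freezing the dual functions at 0 gives an element of \<open>V\<close> with value
    1 at 0 and 0 at \<open>1, ..., sum p I - 1\<close>.\<close>
  define f where "f y = (\<Sum>a<length bs. \<psi> a 0 * (bs ! a) y)" for y
  have "f \<in> V" using bs span_family_iff[of "{..<length bs}" f "(!) bs"]
    by (auto simp: basis_list_def basis_family_def f_def)
  then obtain F where F: "\<And>i k. i \<in> I \<Longrightarrow> p i \<le> k \<Longrightarrow> coeff (F i) k = 0"
    and f: "\<And>x. f x = (\<Sum>i\<in>I. cpow lg (\<alpha> i) x * poly (F i) x)"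
    by (auto simp: V_def quasi_exp_space_def)
  have delta: "(\<Sum>i\<in>I. \<alpha> i ^ j * poly (F i) (of_nat j)) = (if j = 0 then 1 else 0)"
    if "j < sum p I" for j
  proof -
    have "(\<Sum>i\<in>I. \<alpha> i ^ j * poly (F i) (of_nat j)) = f (of_nat j)"
      unfolding f using assms(1,4) by (intro sum.cong) (simp_all add: cpow_of_nat)
    also have "f (of_nat j) = (\<Sum>a<length bs. \<psi> a 0 * (bs ! a) (0 + of_nat j))"
      by (simp add: f_def)
    also have "\<dots> = (if j = 0 then 1 else 0)"
      using \<psi>[unfolded dual_family_def, rule_format, of j 0] that len by simp
    finally show ?thesis .
  qed
  have top: "coeff (F i0) (p i0 - 1) \<noteq> 0" if i0: "i0 \<in> I" for i0
  proof
    assume c0: "coeff (F i0) (p i0 - 1) = 0"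
    define p' where "p' = p(i0 := p i0 - 1)"
    have "sum p I = p i0 + sum p (I - {i0})" "sum p' I = p' i0 + sum p' (I - {i0})"
      using assms(2) i0 by (auto intro: sum.remove)
    moreover have "sum p' (I - {i0}) = sum p (I - {i0})"
      by (rule sum.cong) (auto simp: p'_def)
    ultimately have N: "sum p I = Suc (sum p' I)" using assms(5)[OF i0] by (simp add: p'_def)
    have "smult (\<alpha> i) (F i) = 0" if "i \<in> I" for i
    \<comment> \<open>Sampling starts at 1; the extra factor \<open>\<alpha> i\<close> turns sample
      \<open>j\<close> into the delta condition of index \<open>Suc j\<close>, whose right-hand side
      is 0.\<close>
    proof (rule exp_poly_eq_0[OF assms(2,3,4) _ _ that, of p' "\<lambda>i. smult (\<alpha> i) (F i)" 1])
      fix i k assume i: "i \<in> I" "p' i \<le> k"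
      have "coeff (F i) k = 0"
      proof (cases "p i \<le> k")
        case False
        then have "i = i0" "k = p i0 - 1" using i by (auto simp: p'_def split: if_splits)
        then show ?thesis using c0 by simp
      qed (use F i in simp)
      then show "coeff (smult (\<alpha> i) (F i)) k = 0" by simp
    next
      fix j assume "j < sum p' I"
      then have "(\<Sum>i\<in>I. \<alpha> i ^ Suc j * poly (F i) (of_nat (Suc j))) = 0"
        using delta[of "Suc j"] N by simp
      then show "(\<Sum>i\<in>I. \<alpha> i ^ j * poly (smult (\<alpha> i) (F i)) (1 + of_nat j)) = 0"
        by (simp add: ac_simps)
    qed
    then have "F i = 0" if "i \<in> I" for i using assms(4) that by simp
    then have "(\<Sum>i\<in>I. \<alpha> i ^ 0 * poly (F i) (of_nat 0)) = 0" by simp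
    then show False using delta[of 0] N by simp
  qed
  have "degree (F i) = p i - 1 \<and> F i \<noteq> 0" if "i \<in> I" for i
  proof -
    have "degree (F i) \<le> p i - 1" using F[OF that] by (intro degree_le) auto
    then show ?thesis using le_degree[OF top[OF that]] top[OF that] by auto
  qed
  then show ?thesis using delta by blast
qed

text \<open>
  In the dual family \<open>\<alpha> i ^ (-x) s\<^sub>i\<^sub>k x\<close> of \<open>\<alpha> i ^ x r\<^sub>i\<^sub>k x\<close> the \<open>s\<^sub>i\<^sub>k\<close> are the coefficients of
  \<open>F\<^sub>i (t - x)\<close> with respect to the polynomials \<open>r\<^sub>i\<^sub>k t\<close>.
\<close>

lemma exists_dual_quasi_exp:
  fixes \<alpha> :: "'i \<Rightarrow> complex"
  assumes "log_branch lg" "finite I" "inj_on \<alpha> I" "\<And>i. i \<in> I \<Longrightarrow> \<alpha> i \<noteq> 0"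
    and "\<And>i. i \<in> I \<Longrightarrow> p i > 0"
    and r: "\<And>i k. i \<in> I \<Longrightarrow> k < p i \<Longrightarrow> degree (r i k) = k \<and> r i k \<noteq> 0"
  shows "\<exists>s. (\<forall>i\<in>I. \<forall>k<p i. degree (s i k) = p i - 1 - k \<and> s i k \<noteq> 0) \<and>
    dual_family (sum p I) (SIGMA i:I. {..<p i})
      (\<lambda>(i, k) x. cpow lg (\<alpha> i) x * poly (r i k) x)
      (\<lambda>(i, k) x. cpow lg (\<alpha> i) (- x) * poly (s i k) x)"
proof -
  obtain F where F: "\<And>i. i \<in> I \<Longrightarrow> degree (F i) = p i - 1 \<and> F i \<noteq> 0"
    and delta: "\<And>j. j < sum p I \<Longrightarrow>
      (\<Sum>i\<in>I. \<alpha> i ^ j * poly (F i) (of_nat j)) = (if j = 0 then 1 else 0)"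
    using exists_delta_quasi_exp[OF assms(1-4), of p] assms(5) by auto
  have "\<exists>s. (\<forall>k<p i. degree (s k) = p i - 1 - k \<and> s k \<noteq> 0) \<and>
      (\<forall>x t. (\<Sum>k<p i. poly (s k) x * poly (r i k) t) = poly (F i) (t - x))" if i: "i \<in> I" for i
  proof -
    obtain g where g: "\<And>l. l \<le> p i - 1 \<Longrightarrow> degree (g l) = p i - 1 - l \<and> g l \<noteq> 0"
      "\<And>x t. poly (F i) (t - x) = (\<Sum>l\<le>p i - 1. poly (g l) x * t ^ l)"
      using poly_diff_expansion[of "F i"] F[OF i] by auto
    have "{..p i - 1} = {..<p i}" using assms(5)[OF i] by auto
    then show ?thesis
      using triangular_coefficients[of "p i" "r i" g "p i - 1"] r[OF i] g by auto
  qed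
  then have "\<exists>s. \<forall>i\<in>I. (\<forall>k<p i. degree (s i k) = p i - 1 - k \<and> s i k \<noteq> 0) \<and>
      (\<forall>x t. (\<Sum>k<p i. poly (s i k) x * poly (r i k) t) = poly (F i) (t - x))"
    by (intro bchoice ballI)
  then obtain s where s_F: "\<forall>i\<in>I. (\<forall>k<p i. degree (s i k) = p i - 1 - k \<and> s i k \<noteq> 0) \<and>
      (\<forall>x t. (\<Sum>k<p i. poly (s i k) x * poly (r i k) t) = poly (F i) (t - x))" ..
  then have s: "\<And>i k. i \<in> I \<Longrightarrow> k < p i \<Longrightarrow> degree (s i k) = p i - 1 - k \<and> s i k \<noteq> 0"
    and sF: "\<And>i x t. i \<in> I \<Longrightarrow> (\<Sum>k<p i. poly (s i k) x * poly (r i k) t) = poly (F i) (t - x)"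
    by simp_all
  have "(\<Sum>\<kappa>\<in>(SIGMA i:I. {..<p i}). (case \<kappa> of (i, k) \<Rightarrow> \<lambda>x. cpow lg (\<alpha> i) (- x) * poly (s i k) x) x *
      (case \<kappa> of (i, k) \<Rightarrow> \<lambda>x. cpow lg (\<alpha> i) x * poly (r i k) x) (x + of_nat j)) =
      (if j = 0 then 1 else 0)" if j: "j < sum p I" for x j
  proof -
    have "(\<Sum>\<kappa>\<in>(SIGMA i:I. {..<p i}). (case \<kappa> of (i, k) \<Rightarrow> \<lambda>x. cpow lg (\<alpha> i) (- x) * poly (s i k) x) x *
        (case \<kappa> of (i, k) \<Rightarrow> \<lambda>x. cpow lg (\<alpha> i) x * poly (r i k) x) (x + of_nat j)) =
        (\<Sum>(i, k)\<in>(SIGMA i:I. {..<p i}). \<alpha> i ^ j * (poly (s i k) x * poly (r i k) (x + of_nat j)))"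
      using assms(1,4) by (intro sum.cong) (auto simp: cpow_uminus cpow_add cpow_of_nat)
    also have "\<dots> = (\<Sum>i\<in>I. \<Sum>k<p i. \<alpha> i ^ j * (poly (s i k) x * poly (r i k) (x + of_nat j)))"
      using assms(2) by (intro sum.Sigma[symmetric]) auto
    \<comment> \<open>At \<open>t = x + of_nat j\<close> the argument \<open>t - x\<close> no longer
      depends on \<open>x\<close>, so the delta condition at 0 serves every
      \<open>x\<close>.\<close>
    also have "\<dots> = (\<Sum>i\<in>I. \<alpha> i ^ j * poly (F i) (of_nat j))"
      using sF[of _ x "x + of_nat j"] by (simp add: sum_distrib_left[symmetric])
    finally show ?thesis using delta[OF j] by simp
  qed
  then have "dual_family (sum p I) (SIGMA i:I. {..<p i})
      (\<lambda>(i, k) x. cpow lg (\<alpha> i) x * poly (r i k) x)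
      (\<lambda>(i, k) x. cpow lg (\<alpha> i) (- x) * poly (s i k) x)"
    unfolding dual_family_def by simp
  then show ?thesis using s by (intro exI[of _ s]) simp
qed

subsection \<open>Degrees attached to a partition\<close>

text \<open>Transposition of the Young diagram: since \<open>\<mu>\<close> is nonincreasing, the
  counted indices form an initial segment of the positive integers.\<close>

lemma le_conj_part_iff:
  assumes "is_partition \<mu>" "1 \<le> j" "1 \<le> k"
  shows "k \<le> conj_part \<mu> j \<longleftrightarrow> j \<le> \<mu> k"
proof -
  let ?S = "{l. 1 \<le> l \<and> j \<le> \<mu> l}"
  obtain N where N: "\<And>i. N \<le> i \<Longrightarrow> \<mu> i = 0" using assms(1) by (auto simp: is_partition_def)
  have "?S \<subseteq> {..N}"
  proof
    fix l assume "l \<in> ?S"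
    then show "l \<in> {..N}" using N[of l] assms(2) by (cases "N \<le> l") auto
  qed
  then have fS: "finite ?S" by (rule finite_subset) simp
  show ?thesis
  proof
    assume k: "k \<le> conj_part \<mu> j"
    show "j \<le> \<mu> k"
    proof (rule ccontr)
      assume "\<not> j \<le> \<mu> k"
      have "?S \<subseteq> {1..<k}"
      proof
        fix l assume l: "l \<in> ?S"
        have "\<not> k \<le> l"
        proof
          assume "k \<le> l"
          then have "\<mu> l \<le> \<mu> k" using assms(1,3) by (auto simp: is_partition_def)
          then show False using l \<open>\<not> j \<le> \<mu> k\<close> by simp
        qed
        then show "l \<in> {1..<k}" using l by simp
      qed
      then have "card ?S \<le> k - 1" using card_mono[of "{1..<k}" ?S] by simp
      then show False using k assms(3) by (simp add: conj_part_def)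
    qed
  next
    assume j: "j \<le> \<mu> k"
    have "{1..k} \<subseteq> ?S"
    proof
      fix l assume l: "l \<in> {1..k}"
      then have "\<mu> k \<le> \<mu> l" using assms(1) by (auto simp: is_partition_def)
      then show "l \<in> ?S" using l j by simp
    qed
    then show "k \<le> conj_part \<mu> j" using card_mono[OF fS, of "{1..k}"] by (simp add: conj_part_def)
  qed
qed

text \<open>The values strictly decrease; \<open>j \<le> n\<close> keeps the truncated subtraction
  exact.\<close>

lemma part_degrees_inj:
  assumes "is_partition \<mu>"
  shows "inj_on (\<lambda>j. n + \<mu> j - j) {1..n}"
proof -
  have *: "n + \<mu> k - k < n + \<mu> j - j" if "j \<in> {1..n}" "k \<in> {1..n}" "j < k" for j k
  proof -
    have "\<mu> k \<le> \<mu> j" using assms that by (auto simp: is_partition_def)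
    then show ?thesis using that by auto
  qed
  show ?thesis
  proof (rule inj_onI)
    fix j k assume "j \<in> {1..n}" "k \<in> {1..n}" "n + \<mu> j - j = n + \<mu> k - k"
    then show "j = k" using *[of j k] *[of k j] by (cases j k rule: linorder_cases) auto
  qed
qed

text \<open>The classical complementarity of a partition and its conjugate: the two sequences of
  shifted parts are disjoint, and together they have \<open>m + n\<close> members in
  \<open>{..<m + n}\<close>.\<close>

lemma conj_part_degrees_bij:
  assumes \<mu>: "is_partition \<mu>"
  defines "n \<equiv> conj_part \<mu> 1" and "m \<equiv> \<mu> 1"
  shows "bij_betw (\<lambda>j. n + j - Suc (conj_part \<mu> j)) {1..m}
    ({..<m + n} - (\<lambda>j. n + \<mu> j - j) ` {1..n})"
proof -
  let ?g = "\<lambda>j. n + j - Suc (conj_part \<mu> j)" and ?f = "\<lambda>j. n + \<mu> j - j"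
  have conj_le: "conj_part \<mu> k \<le> conj_part \<mu> j" if "1 \<le> j" "j \<le> k" for j k
  proof (cases "conj_part \<mu> k = 0")
    case False
    then show ?thesis
      using le_conj_part_iff[OF \<mu>, of k "conj_part \<mu> k"] le_conj_part_iff[OF \<mu>, of j "conj_part \<mu> k"] that
      by auto
  qed simp
  have part_le: "\<mu> j \<le> m" if "1 \<le> j" for j
    using \<mu> that by (auto simp: is_partition_def m_def)
  have inj: "inj_on ?g {1..m}"
  proof (rule inj_onI)
    have *: "?g j < ?g k" if "j \<in> {1..m}" "k \<in> {1..m}" "j < k" for j k
      using conj_le[of j k] conj_le[of 1 j] that unfolding n_def by auto
    fix j k assume "j \<in> {1..m}" "k \<in> {1..m}" "?g j = ?g k"
    then show "j = k" using *[of j k] *[of k j] by (cases j k rule: linorder_cases) auto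
  qed
  \<comment> \<open>Equality would mean \<open>conj_part \<mu> j + \<mu> k = j + k - 1\<close>. The
    left side is at least \<open>j + k\<close> if \<open>j \<le> \<mu> k\<close>, and at most
    \<open>j + k - 2\<close> otherwise.\<close>
  have disj: "?g j \<noteq> ?f k" if j: "j \<in> {1..m}" and k: "k \<in> {1..n}" for j k
    using le_conj_part_iff[OF \<mu>, of j k] conj_le[of 1 j] j k unfolding n_def
    by (cases "j \<le> \<mu> k") auto
  have g_sub: "?g ` {1..m} \<subseteq> {..<m + n} - ?f ` {1..n}"
  proof (rule image_subsetI)
    fix j assume j: "j \<in> {1..m}"
    moreover have "?g j < m + n" using j by auto
    ultimately show "?g j \<in> {..<m + n} - ?f ` {1..n}" using disj by blast
  qed
  have f_sub: "?f ` {1..n} \<subseteq> {..<m + n}" using part_le by fastforce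
  have "card ({..<m + n} - ?f ` {1..n}) = m + n - n"
    using f_sub part_degrees_inj[OF \<mu>, of n] by (simp add: card_Diff_subset card_image)
  then have "card (?g ` {1..m}) = card ({..<m + n} - ?f ` {1..n})"
    using card_image[OF inj] by simp
  then have "?g ` {1..m} = {..<m + n} - ?f ` {1..n}"
    using g_sub by (intro card_subset_eq) auto
  then show ?thesis using inj by (simp add: bij_betw_def)
qed

subsection \<open>The space of Wronskian quotients\<close>

text \<open>Resolves the definite description: every admissible pair of lists yields the same span,
  which can be read off from one basis of \<open>W_hat\<close> containing a basis of
  \<open>W\<close>.\<close>

lemma Q_space_eq:
  assumes lg: "log_branch lg" and \<alpha>: "inj_on \<alpha> {1..n}" "\<And>i. i \<in> {1..n} \<Longrightarrow> \<alpha> i \<noteq> 0"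
    and b: "finite K" "basis_family (W_hat lg n \<alpha> \<mu>) K b" "L \<subseteq> K" "cfun.span (b ` L) = W"
    and N: "card K = (\<Sum>i\<in>{1..n}. \<mu> i 1 + conj_part (\<mu> i) 1)"
    and \<psi>: "dual_family (card K) K b \<psi>"
  shows "Q_space lg n \<alpha> \<mu> W = cfun.span (\<psi> ` (K - L))"
proof -
  let ?V = "W_hat lg n \<alpha> \<mu>"
  have V: "?V = quasi_exp_space lg {1..n} \<alpha> (\<lambda>i. \<mu> i 1 + conj_part (\<mu> i) 1)"
    using W_hat_eq lg \<alpha> by blast
  have uni: "unisolvent ?V (card K)"
    unfolding V N using lg \<alpha> by (intro unisolvent_quasi_exp_space) auto
  have sh: "shift f \<in> ?V" if "f \<in> ?V" for f
    using that lg \<alpha>(2) unfolding V by (intro shift_quasi_exp_space) auto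
  have key: "cfun.span (Q_gen fs hs ` {..<length hs}) = cfun.span (\<psi> ` (K - L))"
    if fs: "basis_list W fs" and bs: "basis_list ?V (fs @ hs)" for fs hs
  proof -
    let ?J = "{..<length (fs @ hs)}"
    have len: "length (fs @ hs) = card K"
      using card_basis_family[OF bs[unfolded basis_list_def] b(2)] by simp
    obtain \<psi>' where \<psi>': "dual_family (length (fs @ hs)) ?J ((!) (fs @ hs)) \<psi>'"
      and Q: "cfun.span (Q_gen fs hs ` {..<length hs}) = cfun.span (\<psi>' ` (?J - {..<length fs}))"
      using Q_gen_dual_family[OF bs] uni sh len by auto
    have "(!) (fs @ hs) ` {..<length fs} = (!) fs ` {..<length fs}"
      by (intro image_cong) (auto simp: nth_append)
    then have "cfun.span (b ` L) = cfun.span ((!) (fs @ hs) ` {..<length fs})"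
      using fs b(4) by (simp add: basis_list_def basis_family_def)
    then have "cfun.span (\<psi> ` (K - L)) = cfun.span (\<psi>' ` (?J - {..<length fs}))"
      using span_dual_family_eq[of K ?V b "card K" \<psi> L ?J "(!) (fs @ hs)" \<psi>' "{..<length fs}"]
        b \<psi> \<psi>' bs uni len by (auto simp: basis_list_def)
    then show ?thesis using Q by simp
  qed
  \<comment> \<open>Existence of an admissible pair: list \<open>L\<close> first, then its
    complement in \<open>K\<close>.\<close>
  obtain ls where ls: "set ls = L" "distinct ls"
    using b(1,3) finite_subset finite_distinct_list by metis
  obtain cs where cs: "set cs = K - L" "distinct cs"
    using b(1) finite_Diff finite_distinct_list by metis
  have "basis_family W L b"
    using b(2,3,4) cfun.independent_mono[of "b ` K" "b ` L"] inj_on_subset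
    unfolding basis_family_def by blast
  then have fs: "basis_list W (map b ls)" using ls by (intro basis_list_map) auto
  have "set (ls @ cs) = K" using b(3) ls cs by auto
  then have "basis_list ?V (map b (ls @ cs))"
    using b(2) ls cs by (intro basis_list_map) auto
  then have bs: "basis_list ?V (map b ls @ map b cs)" by simp
  show ?thesis
    unfolding Q_space_def
  proof (rule the_equality)
    show "\<exists>fs hs. basis_list W fs \<and> basis_list ?V (fs @ hs) \<and>
        cfun.span (\<psi> ` (K - L)) = cfun.span (Q_gen fs hs ` {..<length hs})"
      using fs bs key[OF fs bs] by metis
  qed (use key in auto)
qed

theorem proposition2p6:
  fixes lg :: "complex \<Rightarrow> complex"
    and n :: nat
    and \<alpha> :: "nat \<Rightarrow> complex"
    and \<mu> :: "nat \<Rightarrow> nat \<Rightarrow> nat"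
    and q :: "nat \<Rightarrow> nat \<Rightarrow> complex poly"
    and W :: "(complex \<Rightarrow> complex) set"
  assumes "log_branch lg"
    and "inj_on \<alpha> {1..n}"
    and "\<forall>i\<in>{1..n}. \<alpha> i \<noteq> 0"
    and "\<forall>i\<in>{1..n}. nonzero_partition (\<mu> i)"
    and "\<forall>i\<in>{1..n}. \<forall>j\<in>{1..conj_part (\<mu> i) 1}.
           degree (q i j) = conj_part (\<mu> i) 1 + \<mu> i j - j"
    and "basis_family W (SIGMA i:{1..n}. {1..conj_part (\<mu> i) 1})
           (\<lambda>(i, j) x. cpow lg (\<alpha> i) x * poly (q i j) x)"
  shows "\<exists>q' :: nat \<Rightarrow> nat \<Rightarrow> complex poly.
    (\<forall>i\<in>{1..n}. \<forall>j\<in>{1..\<mu> i 1}.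
       degree (q' i j) = \<mu> i 1 + conj_part (\<mu> i) j - j) \<and>
    basis_family (Q_space lg n \<alpha> \<mu> W) (SIGMA i:{1..n}. {1..\<mu> i 1})
      (\<lambda>(i, j) x. cpow lg (\<alpha> i) (- x) * poly (q' i j) x)"
proof -
  define I where "I = {1..n}"
  define c where "c i = conj_part (\<mu> i) 1" for i
  define m where "m i = \<mu> i 1" for i
  define p where "p i = m i + c i" for i
  define d where "d i j = c i + \<mu> i j - j" for i j
  define D where "D i = d i ` {1..c i}" for i
  define K where "K = (SIGMA i:I. {..<p i})"
  define L where "L = (SIGMA i:I. D i)"
  define bW where "bW = (\<lambda>(i, j) x. cpow lg (\<alpha> i) x * poly (q i j) x)"
  have I: "finite I" "inj_on \<alpha> I" "\<And>i. i \<in> I \<Longrightarrow> \<alpha> i \<noteq> 0" using assms(2,3) by (auto simp: I_def)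
  have part: "is_partition (\<mu> i)" if "i \<in> I" for i
    using assms(4) that by (auto simp: I_def nonzero_partition_def)
  have p_pos: "p i > 0" if i: "i \<in> I" for i
  proof -
    obtain j where "1 \<le> j" "\<mu> i j \<noteq> 0"
      using assms(4) i unfolding I_def nonzero_partition_def by blast
    moreover have "\<mu> i j \<le> \<mu> i 1" using part[OF i] \<open>1 \<le> j\<close> by (auto simp: is_partition_def)
    ultimately show ?thesis by (simp add: p_def m_def)
  qed
  have basisW: "basis_family W (SIGMA i:I. {1..c i}) bW"
    using assms(6) by (simp add: I_def c_def bW_def)
  have q_nz: "q i j \<noteq> 0" if ij: "i \<in> I" "j \<in> {1..c i}" for i j
  proof
    assume "q i j = 0"
    then have "bW (i, j) = 0" by (auto simp: bW_def fun_eq_iff)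
    moreover have "bW (i, j) \<in> bW ` (SIGMA i:I. {1..c i})" using ij by blast
    ultimately show False
      using basisW cfun.dependent_zero unfolding basis_family_def by metis
  qed
  have d_inj: "inj_on (d i) {1..c i}" if "i \<in> I" for i
    using part_degrees_inj[OF part[OF that], of "c i"] by (simp add: d_def[abs_def])
  \<comment> \<open>The degrees missing from \<open>D i\<close>; the dual functions at these indices
    will span \<open>Q(W)\<close>.\<close>
  define e where "e i j = c i + j - Suc (conj_part (\<mu> i) j)" for i j
  have e_bij: "bij_betw (e i) {1..m i} ({..<p i} - D i)" if "i \<in> I" for i
    using conj_part_degrees_bij[OF part[OF that]]
    by (simp add: e_def[abs_def] D_def d_def[abs_def] p_def c_def m_def)
  have D_sub: "D i \<subseteq> {..<p i}" if i: "i \<in> I" for i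
  proof -
    have "\<mu> i j \<le> m i" if "1 \<le> j" for j
      using part[OF i] that by (auto simp: is_partition_def m_def)
    then show ?thesis by (fastforce simp: D_def d_def p_def)
  qed
  \<comment> \<open>One polynomial in each degree below \<open>p i\<close>: the given
    \<open>q i j\<close> where a degree of \<open>W\<close> occurs, a monomial elsewhere.\<close>
  define r where "r i k = (if k \<in> D i then q i (the_inv_into {1..c i} (d i) k) else monom 1 k)" for i k
  have r_d: "r i (d i j) = q i j" if "i \<in> I" "j \<in> {1..c i}" for i j
    using that d_inj by (auto simp: r_def D_def the_inv_into_f_f)
  have r: "degree (r i k) = k \<and> r i k \<noteq> 0" if i: "i \<in> I" and "k < p i" for i k
  proof (cases "k \<in> D i")
    case True
    then obtain j where j: "j \<in> {1..c i}" "k = d i j" by (auto simp: D_def)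
    then show ?thesis using r_d[OF i j(1)] q_nz[OF i j(1)] assms(5) i by (auto simp: I_def c_def d_def)
  next
    case False
    then show ?thesis by (simp add: r_def degree_monom_eq)
  qed
  define b where "b = (\<lambda>(i, k) x. cpow lg (\<alpha> i) x * poly (r i k) x)"
  have V: "W_hat lg n \<alpha> \<mu> = quasi_exp_space lg I \<alpha> p"
    using W_hat_eq assms(1-3) unfolding I_def p_def m_def c_def by blast
  have bV: "basis_family (W_hat lg n \<alpha> \<mu>) K b"
    unfolding V K_def b_def using assms(1) I r by (intro basis_quasi_exp_space) auto
  define \<psi> where "\<psi> s = (\<lambda>(i, k) x. cpow lg (\<alpha> i) (- x) * poly (s i k) x)"
    for s :: "nat \<Rightarrow> nat \<Rightarrow> complex poly"
  have "\<exists>s. (\<forall>i\<in>I. \<forall>k<p i. degree (s i k) = p i - 1 - k \<and> s i k \<noteq> 0) \<and>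
      dual_family (sum p I) K b (\<psi> s)"
    unfolding K_def b_def \<psi>_def by (intro exists_dual_quasi_exp assms(1) I p_pos r)
  then obtain s where s: "\<forall>i\<in>I. \<forall>k<p i. degree (s i k) = p i - 1 - k \<and> s i k \<noteq> 0"
    and dual: "dual_family (sum p I) K b (\<psi> s)" by blast
  have cK: "finite K" "card K = sum p I" using I(1) by (auto simp: K_def)
  have L: "L \<subseteq> K" using D_sub by (auto simp: L_def K_def)
  have "b ` L = bW ` (SIGMA i:I. {1..c i})"
  proof -
    have "L = (\<lambda>(i, j). (i, d i j)) ` (SIGMA i:I. {1..c i})" by (auto simp: L_def D_def)
    then have "b ` L = (\<lambda>(i, j). b (i, d i j)) ` (SIGMA i:I. {1..c i})"
      by (simp add: image_image case_prod_unfold)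
    also have "\<dots> = bW ` (SIGMA i:I. {1..c i})"
      by (intro image_cong) (auto simp: b_def bW_def r_d)
    finally show ?thesis .
  qed
  then have spanL: "cfun.span (b ` L) = W" using basisW by (simp add: basis_family_def)
  have Q: "Q_space lg n \<alpha> \<mu> W = cfun.span (\<psi> s ` (K - L))"
    using dual cK
    by (intro Q_space_eq[OF assms(1,2) _ cK(1) bV L spanL])
      (auto simp: \<psi>_def I(3) I_def p_def m_def c_def)
  have KL: "K - L = (SIGMA i:I. {..<p i} - D i)" by (auto simp: K_def L_def)
  have "inj_on (\<psi> s) (K - L) \<and> cfun.independent (\<psi> s ` (K - L))"
    unfolding KL \<psi>_def
  \<comment> \<open>At natural \<open>j\<close> the factor with exponent \<open>- x\<close> equals
    \<open>inverse (\<alpha> i) ^ j\<close>, and for each \<open>i\<close> the degrees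
    \<open>p i - 1 - k\<close> are distinct.\<close>
  proof (rule independent_quasi_exp[of I "\<lambda>i. inverse (\<alpha> i)"])
    show "inj_on (\<lambda>k. degree (s i k)) ({..<p i} - D i)" if "i \<in> I" for i
      using s that by (auto intro!: inj_onI)
    show "inj_on (\<lambda>i. inverse (\<alpha> i)) I" using I(2) by (auto simp: inj_on_def)
  qed (use I s in \<open>auto simp: cpow_uminus cpow_of_nat[OF assms(1)] power_inverse\<close>)
  then have basisQ: "basis_family (Q_space lg n \<alpha> \<mu> W) (K - L) (\<psi> s)"
    by (simp add: basis_family_def Q)
  define h where "h = (\<lambda>(i, j). (i, e i j))"
  have h: "bij_betw h (SIGMA i:I. {1..m i}) (K - L)"
    unfolding KL bij_betw_def
  proof
    show "inj_on h (SIGMA i:I. {1..m i})"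
    proof (rule inj_onI)
      fix u v assume u: "u \<in> (SIGMA i:I. {1..m i})" and v: "v \<in> (SIGMA i:I. {1..m i})"
        and uv: "h u = h v"
      obtain i j where ij: "u = (i, j)" "i \<in> I" "j \<in> {1..m i}" using u by blast
      obtain k where k: "v = (i, k)" "k \<in> {1..m i}" "e i j = e i k"
        using uv v ij by (cases v) (auto simp: h_def)
      have "inj_on (e i) {1..m i}" using e_bij[OF ij(2)] by (simp add: bij_betw_def)
      then show "u = v" using inj_onD[of "e i"] ij k by blast
    qed
    have "h ` (SIGMA i:I. {1..m i}) = (SIGMA i:I. e i ` {1..m i})" by (auto simp: h_def)
    then show "h ` (SIGMA i:I. {1..m i}) = (SIGMA i:I. {..<p i} - D i)"
      using e_bij by (auto simp: bij_betw_def)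
  qed
  define q' where "q' i j = s i (e i j)" for i j
  have "degree (q' i j) = m i + conj_part (\<mu> i) j - j" if i: "i \<in> I" and j: "j \<in> {1..m i}" for i j
  proof -
    have "e i j < p i" using e_bij[OF i] j by (auto simp: bij_betw_def)
    then have deg: "degree (q' i j) = p i - 1 - e i j" using s i by (simp add: q'_def)
    \<comment> \<open>This bound makes the subtraction in \<open>e i j\<close> exact, so that
      \<open>p i - 1 - e i j\<close> simplifies to the required degree.\<close>
    have "conj_part (\<mu> i) j \<le> c i"
    proof (cases "conj_part (\<mu> i) j = 0")
      case False
      then show ?thesis
        using le_conj_part_iff[OF part[OF i], of j "conj_part (\<mu> i) j"]
          le_conj_part_iff[OF part[OF i], of 1 "conj_part (\<mu> i) j"] j by (auto simp: c_def)
    qed simp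
    then show ?thesis using j unfolding deg by (auto simp: p_def e_def)
  qed
  moreover have "\<psi> s \<circ> h = (\<lambda>(i, j) x. cpow lg (\<alpha> i) (- x) * poly (q' i j) x)"
    by (auto simp: \<psi>_def h_def q'_def)
  ultimately show ?thesis
    using basis_family_reindex[OF h basisQ] unfolding I_def m_def by (intro exI[of _ q']) simp
qed

end
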